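(* For any automorphism $\phi$ of the (first) Grigorchuk group one has $R(\phi)=\infty$.
   Context: Reidemeister numbers: for an automorphism $\phi$ of a group $G$, elements $x,y\in G$ are $\phi$-conjugate if $y=gx\phi(g^{-1})$ for some $g\in G$; $R(\phi)$ is the number of equivalence classes (Reidemeister classes). The (first) Grigorchuk group is the group of automorphisms of the rooted binary tree generated by $a,b,c$ (with $d=bc$), where $a$ switches the two subtrees hanging from the root (acting trivially otherwise, i.e. it changes the first letter of a binary word and fixes the other letters), and $b,c,d$ are defined recursively by $b=(a,c)$, $c=(a,d)$, $d=(1,b)$, where $(g_0,g_1)$ denotes the automorphism fixing both vertices of level $1$ and acting as $g_0$ and $g_1$ on the left and right subtrees respectively (each identified with the whole tree). *)

theory Defs
  imports "HOL-Algebra.Generated_Groups" "HOL-Library.Extended_Nat"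
begin

subsection \<open>Reidemeister numbers\<close>

definition twisted_conj :: "('g, 'm) monoid_scheme \<Rightarrow> ('g \<Rightarrow> 'g) \<Rightarrow> ('g \<times> 'g) set"
  where "twisted_conj G \<phi> =
    {(x, y). x \<in> carrier G \<and> y \<in> carrier G \<and>
      (\<exists>g\<in>carrier G. y = g \<otimes>\<^bsub>G\<^esub> x \<otimes>\<^bsub>G\<^esub> \<phi> (inv\<^bsub>G\<^esub> g))}"

definition reidemeister_classes :: "('g, 'm) monoid_scheme \<Rightarrow> ('g \<Rightarrow> 'g) \<Rightarrow> 'g set set"
  where "reidemeister_classes G \<phi> = carrier G // twisted_conj G \<phi>"

definition reidemeister_number :: "('g, 'm) monoid_scheme \<Rightarrow> ('g \<Rightarrow> 'g) \<Rightarrow> enat"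
  where "reidemeister_number G \<phi> =
    (if finite (reidemeister_classes G \<phi>)
     then enat (card (reidemeister_classes G \<phi>)) else \<infinity>)"

lemma equiv_twisted_conj:
  fixes G (structure)
  assumes "group G" and "\<phi> \<in> hom G G"
  shows "equiv (carrier G) (twisted_conj G \<phi>)"
proof -
  interpret group_hom G G \<phi>
    using assms by (intro group_hom.intro group_hom_axioms.intro)
  show ?thesis
  proof (rule equivI)
    show "twisted_conj G \<phi> \<subseteq> carrier G \<times> carrier G"
      by (auto simp: twisted_conj_def)
    show "refl_on (carrier G) (twisted_conj G \<phi>)"
      unfolding refl_on_def twisted_conj_def by (force intro: bexI[of _ "\<one>"])
    show "sym (twisted_conj G \<phi>)"
    proof (rule symI)
      fix x y assume "(x, y) \<in> twisted_conj G \<phi>"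
      then obtain g where g: "x \<in> carrier G" "y \<in> carrier G" "g \<in> carrier G"
        "y = g \<otimes> x \<otimes> \<phi> (inv g)"
        unfolding twisted_conj_def by blast
      have "y \<otimes> \<phi> g = g \<otimes> x"
        using g(1,3) unfolding g(4) by (simp add: m_assoc)
      then have "x = inv g \<otimes> (y \<otimes> \<phi> g)"
        using g(1-3) by (simp add: G.inv_solve_left)
      then have "x = inv g \<otimes> y \<otimes> \<phi> (inv (inv g))"
        using g(1-3) by (simp add: m_assoc)
      moreover have "inv g \<in> carrier G"
        using g(3) by simp
      ultimately show "(y, x) \<in> twisted_conj G \<phi>"
        using g unfolding twisted_conj_def by blast
    qed
    show "trans (twisted_conj G \<phi>)"
    proof (rule transI)
      fix x y z
      assume "(x, y) \<in> twisted_conj G \<phi>" "(y, z) \<in> twisted_conj G \<phi>"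
      then obtain g h where g: "x \<in> carrier G" "y \<in> carrier G" "z \<in> carrier G"
        "g \<in> carrier G" "h \<in> carrier G"
        "y = g \<otimes> x \<otimes> \<phi> (inv g)" "z = h \<otimes> y \<otimes> \<phi> (inv h)"
        unfolding twisted_conj_def by blast
      have "z = (h \<otimes> g) \<otimes> x \<otimes> \<phi> (inv (h \<otimes> g))"
        using g(1,4,5) unfolding g(6,7) by (simp add: m_assoc inv_mult_group)
      moreover have "h \<otimes> g \<in> carrier G"
        using g(4,5) by simp
      ultimately show "(x, z) \<in> twisted_conj G \<phi>"
        using g(1,3) unfolding twisted_conj_def by blast
    qed
  qed
qed


subsection \<open>Automorphisms of the rooted binary tree\<close>

text \<open>
  Vertices are binary words, with root the empty word; the first letter of a word selects
  the left (\<^const>\<open>False\<close>) or right (\<^const>\<open>True\<close>) subtree hanging from the root.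
\<close>

definition tree_adj :: "bool list \<Rightarrow> bool list \<Rightarrow> bool"
  where "tree_adj u v \<longleftrightarrow> (\<exists>x. v = u @ [x] \<or> u = v @ [x])"

definition tree_aut :: "(bool list \<Rightarrow> bool list) monoid"
  where "tree_aut =
    \<lparr>carrier = {f. bij f \<and> f [] = [] \<and> (\<forall>u v. tree_adj (f u) (f v) \<longleftrightarrow> tree_adj u v)},
     mult = (\<circ>), one = id\<rparr>"

lemma group_tree_aut: "group tree_aut"
proof (rule groupI)
  fix f assume f: "f \<in> carrier tree_aut"
  then have "bij f" "f [] = []" and adj: "\<And>u v. tree_adj (f u) (f v) = tree_adj u v"
    by (auto simp: tree_aut_def)
  then have inv: "\<And>u. f (inv_into UNIV f u) = u" "\<And>u. inv_into UNIV f (f u) = u"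
    by (auto simp: bij_def surj_f_inv_f)
  have "inv_into UNIV f [] = []"
    using inv(2)[of "[]"] \<open>f [] = []\<close> by simp
  moreover have "tree_adj (inv_into UNIV f u) (inv_into UNIV f v) = tree_adj u v" for u v
    using adj[of "inv_into UNIV f u" "inv_into UNIV f v"] by (simp add: inv)
  ultimately have "inv_into UNIV f \<in> carrier tree_aut"
    using \<open>bij f\<close> by (simp add: tree_aut_def bij_imp_bij_inv)
  moreover have "inv_into UNIV f \<otimes>\<^bsub>tree_aut\<^esub> f = \<one>\<^bsub>tree_aut\<^esub>"
    by (simp add: tree_aut_def fun_eq_iff inv)
  ultimately show "\<exists>g\<in>carrier tree_aut. g \<otimes>\<^bsub>tree_aut\<^esub> f = \<one>\<^bsub>tree_aut\<^esub>"
    by blast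
qed (auto simp: tree_aut_def bij_comp comp_assoc)

text \<open>The automorphism \<open>(g\<^sub>0, g\<^sub>1)\<close> fixing both vertices of level 1.\<close>

fun tree_pair :: "(bool list \<Rightarrow> bool list) \<Rightarrow> (bool list \<Rightarrow> bool list) \<Rightarrow> bool list \<Rightarrow> bool list"
  where
    "tree_pair g0 g1 [] = []"
  | "tree_pair g0 g1 (False # w) = False # g0 w"
  | "tree_pair g0 g1 (True # w) = True # g1 w"


subsection \<open>The first Grigorchuk group\<close>

fun grig_a :: "bool list \<Rightarrow> bool list"
  where
    "grig_a [] = []"
  | "grig_a (x # w) = (\<not> x) # w"

fun grig_b :: "bool list \<Rightarrow> bool list"
  and grig_c :: "bool list \<Rightarrow> bool list"
  and grig_d :: "bool list \<Rightarrow> bool list"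
  where
    "grig_b [] = []"
  | "grig_b (False # w) = False # grig_a w"
  | "grig_b (True # w) = True # grig_c w"
  | "grig_c [] = []"
  | "grig_c (False # w) = False # grig_a w"
  | "grig_c (True # w) = True # grig_d w"
  | "grig_d [] = []"
  | "grig_d (False # w) = False # w"
  | "grig_d (True # w) = True # grig_b w"

lemma grig_recursion:
  shows "grig_b = tree_pair grig_a grig_c"
    and "grig_c = tree_pair grig_a grig_d"
    and "grig_d = tree_pair id grig_b"
proof -
  have "grig_b w = tree_pair grig_a grig_c w \<and> grig_c w = tree_pair grig_a grig_d w
    \<and> grig_d w = tree_pair id grig_b w" for w
  proof (cases w)
    case (Cons x v)
    then show ?thesis by (cases x) auto
  qed simp
  then show "grig_b = tree_pair grig_a grig_c" "grig_c = tree_pair grig_a grig_d"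
    "grig_d = tree_pair id grig_b"
    by auto
qed

lemma grig_a_involution: "grig_a (grig_a w) = w"
  by (cases w) auto

lemma grig_bcd_involution:
  "grig_b (grig_b w) = w \<and> grig_c (grig_c w) = w \<and> grig_d (grig_d w) = w"
proof (induction w)
  case (Cons x w)
  then show ?case by (cases x) (auto simp: grig_a_involution)
qed simp

lemma grig_mult:
  "grig_b (grig_c w) = grig_d w \<and> grig_c (grig_d w) = grig_b w \<and> grig_d (grig_b w) = grig_c w"
proof (induction w)
  case (Cons x w)
  then show ?case by (cases x) (auto simp: grig_a_involution)
qed simp

lemma grig_d_eq: "grig_d = grig_b \<circ> grig_c"
  by (simp add: fun_eq_iff grig_mult)

lemma tree_aut_involutionI:
  assumes invol: "\<And>w. f (f w) = w" and root: "f [] = []"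
    and child: "\<And>w x. \<exists>y. f (w @ [x]) = f w @ [y]"
  shows "f \<in> carrier tree_aut"
proof -
  have "bij f"
    by (rule o_bij[of f]) (auto simp: invol)
  moreover have adj: "tree_adj (f u) (f v)" if "tree_adj u v" for u v
    using that child unfolding tree_adj_def by metis
  moreover have "tree_adj u v" if "tree_adj (f u) (f v)" for u v
    using adj[OF that] by (simp add: invol)
  ultimately have "bij f \<and> f [] = [] \<and> (\<forall>u v. tree_adj (f u) (f v) \<longleftrightarrow> tree_adj u v)"
    using root by blast
  then show ?thesis
    by (simp add: tree_aut_def)
qed

lemma grig_a_child: "\<exists>y. grig_a (w @ [x]) = grig_a w @ [y]"
  by (cases w) auto

lemma grig_bcd_child:
  "(\<exists>y. grig_b (w @ [x]) = grig_b w @ [y]) \<and> (\<exists>y. grig_c (w @ [x]) = grig_c w @ [y])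
    \<and> (\<exists>y. grig_d (w @ [x]) = grig_d w @ [y])"
proof (induction w)
  case Nil
  then show ?case by (cases x) auto
next
  case (Cons z w)
  then show ?case using grig_a_child[of w x] by (cases z) auto
qed

lemma grig_in_tree_aut: "{grig_a, grig_b, grig_c, grig_d} \<subseteq> carrier tree_aut"
  by (auto intro!: tree_aut_involutionI
      simp: grig_a_involution grig_bcd_involution grig_a_child grig_bcd_child)

definition grigorchuk_group :: "(bool list \<Rightarrow> bool list) monoid"
  where "grigorchuk_group = tree_aut\<lparr>carrier := generate tree_aut {grig_a, grig_b, grig_c}\<rparr>"

lemma group_grigorchuk_group: "group grigorchuk_group"
proof -
  interpret T: group tree_aut by (rule group_tree_aut)
  have "subgroup (generate tree_aut {grig_a, grig_b, grig_c}) tree_aut"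
    using grig_in_tree_aut by (intro T.generate_is_subgroup) auto
  then show ?thesis
    unfolding grigorchuk_group_def by (rule T.subgroup_imp_group)
qed

end

theory Submission
  imports Defs "HOL-Library.Sublist"
begin

text \<open>
  Write \<open>G\<close> for the Grigorchuk group and \<open>T\<^sub>v\<close> for the subtree below a vertex \<open>v\<close>.  The proof has two
  halves: every automorphism is conjugation by a tree automorphism as far as any given finite level
  can see, and a coset of \<open>G\<close> on a deep level splits into many conjugacy classes.

  Rigidity.  Rigid stabilisers of vertices are nontrivial and hence non-commutative, in \<open>G\<close> and in
  each nontrivial normal subgroup \<open>L\<close>.  A double commutator therefore shows that an element
  commuting with a subset \<open>N\<close> normalised by \<open>L\<close> fixes every vertex moved by \<open>N\<close>
  (\<open>centraliser_fixes_moved\<close>).  Let \<open>L\<close> be a term of the derived series: it is characteristic,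
  nontrivial, and the \<open>n\<close>-th term fixes level \<open>n\<close>.  If \<open>l\<close> is the deepest level that \<open>L\<close> fixes,
  then \<open>L\<close> acts transitively on every level of every \<open>T\<^sub>v\<close> with \<open>|v| = l\<close>
  (\<open>normal_subtree_transitive\<close>), and it follows that the maximal centralisers of nontrivial subsets
  normalised by \<open>L\<close> are exactly the pointwise fixators of the \<open>T\<^sub>v\<close>.  That description is invariant
  under an automorphism \<open>\<phi>\<close>, which hence permutes the vertices of level \<open>l\<close>, compatibly with the
  action of \<open>G\<close> (\<open>iso_fixator\<close>).  Two vertices are siblings iff the stabiliser of one fixes the
  other; therefore the permutation respects siblings, and inductively all prefixes, and extends to
  a tree automorphism \<open>t\<close> with \<open>t g = \<phi>(g) t\<close> on level \<open>l\<close>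
  (\<open>automorphism_induced_on_level\<close>).  Here \<open>l\<close> is as large as desired.

  Counting.  Let \<open>H\<close> be the image of \<open>G\<close> in the symmetric group of level \<open>l\<close>.  The map
  \<open>x \<mapsto> x t\<close> sends the \<open>\<phi>\<close>-conjugacy classes of \<open>G\<close> onto the \<open>H\<close>-conjugacy classes of the coset
  \<open>H t\<close>.  If \<open>y\<close> in the coset fixes \<open>1\<^sup>j\<close>, it also fixes the siblings \<open>1\<^sup>i0\<close>, \<open>i < j\<close>.  For
  each of them \<open>y\<close> acts on the elements of \<open>H\<close> supported below \<open>1\<^sup>i0\<close>, a nontrivial two-group, with
  two-power order, and so centralises a nontrivial one; thus its centraliser in \<open>H\<close> has at least
  \<open>2\<^sup>j\<close> elements and its class at most \<open>|H| / 2\<^sup>j\<close> (\<open>card_centraliser_ge\<close>).  By transitivity, the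
  \<open>y\<close> that fix \<open>1\<^sup>j\<close> and swap its children are \<open>|H| / 2\<^sup>j / 2\<close> in number.  The number of
  classes is the sum of the reciprocal class sizes over the coset, so that each \<open>j\<close> contributes at
  least one half, and the number of classes is unbounded as \<open>l\<close> grows.
\<close>

section \<open>Tree automorphisms as length- and prefix-preserving bijections\<close>

text \<open>
  Preserving lengths and prefixes replaces the adjacency condition for tree automorphisms because it
  can be checked by recursion on words.
\<close>

definition tree_maps :: "(bool list \<Rightarrow> bool list) set"
  where "tree_maps = {f. bij f \<and> (\<forall>w. length (f w) = length w) \<and> (\<forall>k w. f (take k w) = take k (f w))}"

abbreviation finv :: "('a \<Rightarrow> 'a) \<Rightarrow> 'a \<Rightarrow> 'a"
  where "finv \<equiv> inv_into UNIV"

abbreviation ones :: "nat \<Rightarrow> bool list"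
  where "ones n \<equiv> replicate n True"

lemma tree_mapsD:
  assumes "f \<in> tree_maps"
  shows "bij f" "length (f w) = length w" "f (take k w) = take k (f w)"
  using assms by (auto simp: tree_maps_def)

lemma tree_maps_eq_iff: "f \<in> tree_maps \<Longrightarrow> f u = f v \<longleftrightarrow> u = v"
  using tree_mapsD(1) by (metis bij_pointE)

lemma tree_maps_inv:
  assumes "f \<in> tree_maps"
  shows "finv f (f w) = w" "f (finv f w) = w" "finv f \<in> tree_maps"
proof -
  have b: "bij f" using assms by (rule tree_mapsD)
  show l: "finv f (f w) = w" and r: "f (finv f w) = w" for w
    using b by (auto simp: bij_def surj_f_inv_f)
  have "finv f (take k w) = take k (finv f w)" for k w
    using tree_maps_eq_iff[OF assms] by (metis r tree_mapsD(3)[OF assms])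
  moreover have "length (finv f w) = length w" for w
    by (metis r tree_mapsD(2)[OF assms])
  ultimately show "finv f \<in> tree_maps"
    unfolding tree_maps_def using bij_imp_bij_inv[OF b] by auto
qed

lemma tree_maps_id: "id \<in> tree_maps"
  by (simp add: tree_maps_def)

lemma tree_maps_comp: "f \<in> tree_maps \<Longrightarrow> g \<in> tree_maps \<Longrightarrow> f \<circ> g \<in> tree_maps"
  by (auto simp: tree_maps_def bij_comp)

lemma prefix_iff_take: "prefix u w \<longleftrightarrow> take (length u) w = u"
  by (metis append_eq_conv_conj prefix_def take_is_prefix)

lemma tree_maps_prefix: "f \<in> tree_maps \<Longrightarrow> prefix (f u) (f w) \<longleftrightarrow> prefix u w"
  by (metis prefix_iff_take tree_mapsD(2,3) tree_maps_eq_iff)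

lemma tree_maps_fix_prefix: "f \<in> tree_maps \<Longrightarrow> f w = w \<Longrightarrow> prefix u w \<Longrightarrow> f u = u"
  by (metis prefix_iff_take tree_mapsD(3))

lemma tree_maps_children:
  assumes f: "f \<in> tree_maps" and u: "f u = u"
  shows "\<exists>e. \<forall>x. f (u @ [x]) = u @ [e \<noteq> x]"
proof -
  have "\<exists>y. f (u @ [x]) = u @ [y]" for x
  proof -
    have "take (length u) (f (u @ [x])) = u"
      using tree_mapsD(3)[OF f, of "length u" "u @ [x]"] u by simp
    then show ?thesis
      using tree_mapsD(2)[OF f, of "u @ [x]"] by (cases "f (u @ [x])" rule: rev_cases) auto
  qed
  then obtain y where y: "\<And>x. f (u @ [x]) = u @ [y x]" by metis
  have "y True \<noteq> y False"
    using y[of True] y[of False] tree_maps_eq_iff[OF f, of "u @ [True]" "u @ [False]"] by auto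
  then have "f (u @ [x]) = u @ [y False \<noteq> x]" for x
    unfolding y by (cases x) auto
  then show ?thesis by blast
qed

text \<open>
  A level determines the action above it, each shorter word being a prefix of a word on that level.
\<close>

lemma tree_maps_eq_upto:
  assumes f: "f \<in> tree_maps" and g: "g \<in> tree_maps"
    and eq: "\<And>w. length w = n \<Longrightarrow> f w = g w" and "length w \<le> n"
  shows "f w = g w"
proof -
  define v where "v = w @ ones (n - length w)"
  have "length v = n" "w = take (length w) v"
    using assms(4) by (auto simp: v_def)
  then show ?thesis
    using eq tree_mapsD(3)[OF f] tree_mapsD(3)[OF g] by metis
qed

section \<open>The Grigorchuk group as a self-replicating group of maps\<close>

abbreviation Grig :: "(bool list \<Rightarrow> bool list) set"
  where "Grig \<equiv> carrier grigorchuk_group"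

lemma Grig_mult [simp]: "f \<otimes>\<^bsub>grigorchuk_group\<^esub> g = f \<circ> g"
  by (simp add: grigorchuk_group_def tree_aut_def)

lemma Grig_one [simp]: "\<one>\<^bsub>grigorchuk_group\<^esub> = id"
  by (simp add: grigorchuk_group_def tree_aut_def)

lemma Grig_comp: "f \<in> Grig \<Longrightarrow> g \<in> Grig \<Longrightarrow> f \<circ> g \<in> Grig"
  using group.is_monoid[OF group_grigorchuk_group] monoid.m_closed Grig_mult by metis

lemma Grig_id: "id \<in> Grig"
  using group.is_monoid[OF group_grigorchuk_group] monoid.one_closed Grig_one by metis

lemma Grig_gens: "grig_a \<in> Grig" "grig_b \<in> Grig" "grig_c \<in> Grig" "grig_d \<in> Grig"
proof -
  show *: "grig_a \<in> Grig" "grig_b \<in> Grig" "grig_c \<in> Grig"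
    by (auto simp: grigorchuk_group_def intro: generate.incl)
  show "grig_d \<in> Grig"
    unfolding grig_d_eq using * by (intro Grig_comp)
qed

lemma mult_tree_aut: "f \<otimes>\<^bsub>tree_aut\<^esub> g = f \<circ> g"
  by (simp add: tree_aut_def)

lemma one_tree_aut: "\<one>\<^bsub>tree_aut\<^esub> = id"
  by (simp add: tree_aut_def)

text \<open>
  The generators are involutions, so that inverses of generators need no case of their own.
\<close>

lemma Grig_induct [consumes 1, case_names id a b c comp]:
  assumes g: "g \<in> Grig" and "P id" "P grig_a" "P grig_b" "P grig_c"
    and comp: "\<And>f g. f \<in> Grig \<Longrightarrow> g \<in> Grig \<Longrightarrow> P f \<Longrightarrow> P g \<Longrightarrow> P (f \<circ> g)"
  shows "P g"
proof -
  interpret T: group tree_aut by (rule group_tree_aut)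
  let ?S = "{grig_a, grig_b, grig_c}"
  have inv: "inv\<^bsub>tree_aut\<^esub> h = h" if "h \<in> ?S" for h
  proof (rule T.inv_equality)
    show "h \<otimes>\<^bsub>tree_aut\<^esub> h = \<one>\<^bsub>tree_aut\<^esub>"
      using that by (auto simp: tree_aut_def fun_eq_iff grig_a_involution grig_bcd_involution)
  qed (use that grig_in_tree_aut in auto)
  have "g \<in> generate tree_aut ?S"
    using g by (simp add: grigorchuk_group_def)
  then show ?thesis
  proof induction
    case (eng f h)
    then have "f \<in> Grig" "h \<in> Grig"
      by (auto simp: grigorchuk_group_def)
    then show ?case
      using comp eng.IH by (metis mult_tree_aut)
  next
    case one
    then show ?case using assms by (metis one_tree_aut)
  qed (use assms inv in auto)
qed

lemma involution_tree_mapsI: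
  assumes "\<And>w. f (f w) = w" "\<And>w. length (f w) = length w" "\<And>k w. f (take k w) = take k (f w)"
  shows "f \<in> tree_maps"
  using assms by (auto simp: tree_maps_def intro!: o_bij[of f])

lemma grig_a_tree_maps: "grig_a \<in> tree_maps"
proof (rule involution_tree_mapsI)
  show "length (grig_a w) = length w" for w by (cases w) auto
  show "grig_a (take k w) = take k (grig_a w)" for k w by (cases w; cases k) auto
qed (rule grig_a_involution)

lemma grig_bcd_tree_maps: "grig_b \<in> tree_maps" "grig_c \<in> tree_maps" "grig_d \<in> tree_maps"
proof -
  have len: "length (grig_b w) = length w \<and> length (grig_c w) = length w \<and> length (grig_d w) = length w" for w
  proof (induction w)
    case (Cons x w)
    then show ?case by (cases x) (auto simp: tree_mapsD(2)[OF grig_a_tree_maps])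
  qed simp
  have take: "grig_b (take k w) = take k (grig_b w) \<and> grig_c (take k w) = take k (grig_c w)
      \<and> grig_d (take k w) = take k (grig_d w)" for k w
  proof (induction w arbitrary: k)
    case (Cons x w)
    then show ?case by (cases x; cases k) (auto simp: tree_mapsD(3)[OF grig_a_tree_maps])
  qed simp
  show "grig_b \<in> tree_maps" "grig_c \<in> tree_maps" "grig_d \<in> tree_maps"
    using len take grig_bcd_involution by (auto intro!: involution_tree_mapsI)
qed

lemma Grig_tree_maps: "g \<in> Grig \<Longrightarrow> g \<in> tree_maps"
  by (induction rule: Grig_induct)
    (rule tree_maps_id tree_maps_comp grig_a_tree_maps grig_bcd_tree_maps | assumption)+

lemmas Grig_length [simp] = tree_mapsD(2)[OF Grig_tree_maps]
lemmas Grig_take = tree_mapsD(3)[OF Grig_tree_maps]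
lemmas Grig_prefix = tree_maps_prefix[OF Grig_tree_maps]
lemmas Grig_eq_iff = tree_maps_eq_iff[OF Grig_tree_maps]
lemmas Grig_inv [simp] = tree_maps_inv(1,2)[OF Grig_tree_maps]

lemma Grig_m_inv:
  assumes "g \<in> Grig"
  shows "inv\<^bsub>grigorchuk_group\<^esub> g = finv g"
proof -
  interpret G: group grigorchuk_group by (rule group_grigorchuk_group)
  have "(inv\<^bsub>grigorchuk_group\<^esub> g) \<circ> g = id"
    using G.l_inv[OF assms] by simp
  then have "(inv\<^bsub>grigorchuk_group\<^esub> g) (g w) = w" for w
    by (metis comp_apply id_apply)
  then show ?thesis
    using Grig_inv(2)[OF assms] by (metis ext)
qed

lemma Grig_finv: "g \<in> Grig \<Longrightarrow> finv g \<in> Grig"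
  using group.inv_closed[OF group_grigorchuk_group] Grig_m_inv by metis

text \<open>
  By \<open>b = (a, c)\<close>, \<open>c = (a, d)\<close>, \<open>d = (1, b)\<close>, all generators occur as sections at the right vertex
  or, after conjugation by \<open>a\<close>, at the left one.
\<close>

lemma self_replicating_letter:
  assumes "g \<in> Grig"
  shows "\<exists>h\<in>Grig. \<forall>w. h (x # w) = x # g w"
  using assms
proof (induction rule: Grig_induct)
  case id
  then show ?case using Grig_id by (intro bexI[of _ id]) auto
next
  case a
  define h where "h = (if x then grig_a \<circ> grig_b \<circ> grig_a else grig_b)"
  have "h \<in> Grig"
    unfolding h_def using Grig_gens by (cases x) (simp_all, intro Grig_comp Grig_gens)
  moreover have "h (x # w) = x # grig_a w" for w
    by (cases x) (auto simp: h_def)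
  ultimately show ?case by blast
next
  case b
  define h where "h = (if x then grig_d else grig_a \<circ> grig_d \<circ> grig_a)"
  have "h \<in> Grig"
    unfolding h_def using Grig_gens by (cases x) (simp_all, intro Grig_comp Grig_gens)
  moreover have "h (x # w) = x # grig_b w" for w
    by (cases x) (auto simp: h_def)
  ultimately show ?case by blast
next
  case c
  define h where "h = (if x then grig_b else grig_a \<circ> grig_b \<circ> grig_a)"
  have "h \<in> Grig"
    unfolding h_def using Grig_gens by (cases x) (simp_all, intro Grig_comp Grig_gens)
  moreover have "h (x # w) = x # grig_c w" for w
    by (cases x) (auto simp: h_def)
  ultimately show ?case by blast
next
  case (comp f g)
  then obtain f' g' where "f' \<in> Grig" "g' \<in> Grig" "\<forall>w. f' (x # w) = x # f w" "\<forall>w. g' (x # w) = x # g w"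
    by blast
  then show ?case by (intro bexI[of _ "f' \<circ> g'"]) (auto intro: Grig_comp)
qed

lemma self_replicating:
  assumes "g \<in> Grig"
  obtains h where "h \<in> Grig" "\<And>w. h (u @ w) = u @ g w"
proof -
  have "\<exists>h\<in>Grig. \<forall>w. h (u @ w) = u @ g w"
  proof (induction u)
    case Nil
    then show ?case using assms by auto
  next
    case (Cons x u)
    then obtain h where "h \<in> Grig" "\<forall>w. h (u @ w) = u @ g w" by blast
    then show ?case
      using self_replicating_letter[of h x] by (metis append_Cons)
  qed
  then show ?thesis using that by blast
qed

lemma Grig_to_ones: "\<exists>g\<in>Grig. g w = ones (length w)"
proof (induction w)
  case Nil
  then show ?case using Grig_id by (intro bexI[of _ id]) auto
next
  case (Cons x w)
  then obtain g where g: "g \<in> Grig" "g w = ones (length w)" by blast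
  then obtain h where h: "h \<in> Grig" "\<And>v. h ([True] @ v) = [True] @ g v"
    using self_replicating by metis
  show ?case
  proof (cases x)
    case True
    then show ?thesis using h g by (intro bexI[of _ h]) auto
  next
    case False
    then show ?thesis using h g Grig_gens by (intro bexI[of _ "h \<circ> grig_a"]) (auto intro: Grig_comp)
  qed
qed

lemma Grig_transitive:
  assumes "length u = length v"
  obtains g where "g \<in> Grig" "g u = v"
proof -
  obtain f h where "f \<in> Grig" "f u = ones (length u)" "h \<in> Grig" "h v = ones (length v)"
    using Grig_to_ones by meson
  then have "finv h \<circ> f \<in> Grig" "(finv h \<circ> f) u = v"
    using assms by (auto intro: Grig_comp Grig_finv) (metis Grig_inv(1))
  then show ?thesis using that by blast
qed

section \<open>The stabiliser of a ray\<close>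

text \<open>
  The rigidity argument needs that the stabiliser of the rightmost ray moves the vertices below
  \<open>1\<^sup>i0\<close> as freely as possible.  By self-replication only \<open>i = 0\<close> matters.  The elements \<open>x\<close> with
  \<open>(x, 1)\<close> in the group form a normal subgroup containing \<open>b\<close>; its sections at the right vertex form
  a normal subgroup containing \<open>a\<close> and \<open>c\<close>; the sections of that one already exhaust the group.
\<close>

definition left_kernel :: "(bool list \<Rightarrow> bool list) set"
  where "left_kernel = {x \<in> Grig. tree_pair x id \<in> Grig}"

definition right_sections :: "(bool list \<Rightarrow> bool list) set \<Rightarrow> (bool list \<Rightarrow> bool list) set"
  where "right_sections S = {y \<in> Grig. \<exists>x\<in>S. \<forall>w. x (True # w) = True # y w}"

text \<open>
  A normal subgroup up to inverses: all memberships below are witnessed by products and conjugates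
  alone.
\<close>

definition conj_closed :: "(bool list \<Rightarrow> bool list) set \<Rightarrow> bool"
  where "conj_closed S \<longleftrightarrow> (\<forall>x\<in>S. \<forall>y\<in>S. x \<circ> y \<in> S) \<and> (\<forall>x\<in>S. \<forall>g\<in>Grig. g \<circ> x \<circ> finv g \<in> S)"

lemma conj_closed_comp: "conj_closed S \<Longrightarrow> x \<in> S \<Longrightarrow> y \<in> S \<Longrightarrow> x \<circ> y \<in> S"
  by (auto simp: conj_closed_def)

lemma conj_closed_conj: "conj_closed S \<Longrightarrow> x \<in> S \<Longrightarrow> g \<in> Grig \<Longrightarrow> g \<circ> x \<circ> finv g \<in> S"
  by (auto simp: conj_closed_def)

lemma finv_gens: "finv grig_a = grig_a" "finv grig_b = grig_b" "finv grig_c = grig_c" "finv grig_d = grig_d"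
  using Grig_inv(2) Grig_gens grig_a_involution grig_bcd_involution by (metis ext)+

text \<open>
  An element fixing one vertex of level one fixes both, so a section at one of them comes with a
  section at the other.
\<close>

lemma Grig_letter_complement:
  assumes h: "h \<in> Grig" "\<And>w. h (x # w) = x # g w" and "y \<noteq> x"
  shows "\<exists>k. \<forall>w. h (y # w) = y # k w"
proof -
  have "length (h [x]) = 1" using Grig_length[OF h(1)] by simp
  then have "h [x] = [x]" using h(2)[of "[]"] by (simp add: length_Suc_conv)
  then have ne: "h [y] \<noteq> [x]"
    using Grig_eq_iff[OF h(1), of "[y]" "[x]"] assms(3) by simp
  have "length (h [y]) = 1" using Grig_length[OF h(1)] by simp
  then obtain z where z: "h [y] = [z]" by (auto simp: length_Suc_conv)
  then have "z = y" using ne assms(3) by simp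
  then have fx: "h [y] = [y]" using z by simp
  have "h (y # w) = y # tl (h (y # w))" for w
  proof -
    have "take 1 (h (y # w)) = [y]"
      using Grig_take[OF h(1), of 1 "y # w"] fx by simp
    then show ?thesis by (cases "h (y # w)") simp_all
  qed
  then show ?thesis by (intro exI[of _ "\<lambda>w. tl (h (y # w))"]) blast
qed

text \<open>
  Given \<open>g\<close>, self-replication yields \<open>h = (g, k)\<close> for some \<open>k\<close>, and conjugating \<open>(x, 1)\<close> by it does
  not depend on \<open>k\<close>.
\<close>

lemma left_kernel_conj_closed: "conj_closed left_kernel"
  unfolding conj_closed_def
proof (intro conjI ballI)
  fix x y assume xy: "x \<in> left_kernel" "y \<in> left_kernel"
  have "tree_pair (x \<circ> y) id w = (tree_pair x id \<circ> tree_pair y id) w" for w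
    by (cases "(x, id :: bool list \<Rightarrow> bool list, w)" rule: tree_pair.cases) auto
  then have "tree_pair (x \<circ> y) id = tree_pair x id \<circ> tree_pair y id"
    by (rule ext)
  then show "x \<circ> y \<in> left_kernel"
    using xy by (auto simp: left_kernel_def intro: Grig_comp)
next
  fix x g assume x: "x \<in> left_kernel" and g: "g \<in> Grig"
  obtain h where h: "h \<in> Grig" "\<And>w. h (False # w) = False # g w"
    using self_replicating_letter[OF g] by metis
  obtain k where k: "\<And>w. h (True # w) = True # k w"
    using Grig_letter_complement[OF h, of True] by auto
  have "(h \<circ> tree_pair x id) w = (tree_pair (g \<circ> x \<circ> finv g) id \<circ> h) w" for w
  proof (cases w)
    case Nil
    then show ?thesis using Grig_length[OF h(1), of "[]"] by simp
  next
    case (Cons y v)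
    then show ?thesis using h(2) k g by (cases y) auto
  qed
  from this[of "finv h w" for w]
  have "tree_pair (g \<circ> x \<circ> finv g) id w = (h \<circ> tree_pair x id \<circ> finv h) w" for w
    using Grig_inv(2)[OF h(1)] by simp
  then have "tree_pair (g \<circ> x \<circ> finv g) id = h \<circ> tree_pair x id \<circ> finv h"
    by (rule ext)
  then show "g \<circ> x \<circ> finv g \<in> left_kernel"
    using x g h(1) unfolding left_kernel_def by (auto intro!: Grig_comp Grig_finv)
qed

lemma right_sections_conj_closed:
  assumes S: "conj_closed S" "S \<subseteq> Grig"
  shows "conj_closed (right_sections S)"
  unfolding conj_closed_def
proof (intro conjI ballI)
  fix y z assume "y \<in> right_sections S" "z \<in> right_sections S"
  then obtain u v where "y \<in> Grig" "z \<in> Grig" "u \<in> S" "v \<in> S" "\<forall>w. u (True # w) = True # y w"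
    "\<forall>w. v (True # w) = True # z w"
    by (auto simp: right_sections_def)
  then show "y \<circ> z \<in> right_sections S"
    unfolding right_sections_def using conj_closed_comp[OF S(1)]
    by (auto intro!: Grig_comp bexI[of _ "u \<circ> v"])
next
  fix y g assume "y \<in> right_sections S" and g: "g \<in> Grig"
  then obtain u where u: "y \<in> Grig" "u \<in> S" "\<forall>w. u (True # w) = True # y w"
    by (auto simp: right_sections_def)
  obtain h where h: "h \<in> Grig" "\<And>w. h (True # w) = True # g w"
    using self_replicating_letter[OF g] by metis
  have "finv h (True # w) = True # finv g w" for w
    using h(2)[of "finv g w"] g Grig_inv(1)[OF h(1)] by (metis Grig_inv(2))
  then have "\<forall>w. (h \<circ> u \<circ> finv h) (True # w) = True # (g \<circ> y \<circ> finv g) w"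
    using h u by simp
  moreover have "h \<circ> u \<circ> finv h \<in> S" "g \<circ> y \<circ> finv g \<in> Grig"
    using conj_closed_conj[OF S(1)] h(1) u g by (auto intro!: Grig_comp Grig_finv)
  ultimately show "g \<circ> y \<circ> finv g \<in> right_sections S"
    unfolding right_sections_def by blast
qed

lemma left_kernel_b: "grig_b \<in> left_kernel"
proof -
  have "tree_pair grig_b id w = (grig_a \<circ> grig_d \<circ> grig_a) w" for w
    by (cases "(grig_b, id :: bool list \<Rightarrow> bool list, w)" rule: tree_pair.cases) auto
  then have "tree_pair grig_b id = grig_a \<circ> grig_d \<circ> grig_a" by (rule ext)
  then show ?thesis
    unfolding left_kernel_def using Grig_gens by (auto intro!: Grig_comp)
qed

abbreviation (input) "kernel_sections \<equiv> right_sections left_kernel"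

lemma kernel_sections_conj_closed: "conj_closed kernel_sections"
  by (intro right_sections_conj_closed left_kernel_conj_closed) (auto simp: left_kernel_def)

text \<open>
  Since \<open>b = (a, c)\<close> and \<open>a b a = (c, a)\<close> both lie in the left kernel.
\<close>

lemma kernel_sections_ac: "grig_a \<in> kernel_sections" "grig_c \<in> kernel_sections"
proof -
  have "grig_a \<circ> grig_b \<circ> grig_a \<in> left_kernel"
    using conj_closed_conj[OF left_kernel_conj_closed left_kernel_b Grig_gens(1)] by (simp add: finv_gens)
  then show "grig_a \<in> kernel_sections"
    unfolding right_sections_def using Grig_gens by (auto intro!: bexI[of _ "grig_a \<circ> grig_b \<circ> grig_a"])
  show "grig_c \<in> kernel_sections"
    unfolding right_sections_def using Grig_gens left_kernel_b by (auto intro!: bexI[of _ grig_b])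
qed

text \<open>
  The sections of \<open>c\<close>, \<open>a c a\<close> and \<open>a b a b\<close> at the right vertex are \<open>d\<close>, \<open>a\<close> and \<open>a c\<close>, which
  generate the group.
\<close>

lemma right_sections_kernel_sections: "right_sections kernel_sections = Grig"
proof -
  let ?Q = "right_sections kernel_sections"
  have Q: "conj_closed ?Q"
    by (intro right_sections_conj_closed kernel_sections_conj_closed) (auto simp: right_sections_def)
  have d: "grig_d \<in> ?Q"
    using kernel_sections_ac Grig_gens by (auto simp: right_sections_def[of kernel_sections] intro!: bexI[of _ grig_c])
  have "grig_a \<circ> grig_c \<circ> grig_a \<in> kernel_sections"
    using conj_closed_conj[OF kernel_sections_conj_closed kernel_sections_ac(2) Grig_gens(1)] by (simp add: finv_gens)
  then have a: "grig_a \<in> ?Q"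
    using Grig_gens by (auto simp: right_sections_def[of kernel_sections] intro!: bexI[of _ "grig_a \<circ> grig_c \<circ> grig_a"])
  have "grig_a \<circ> (grig_b \<circ> grig_a \<circ> grig_b) \<in> kernel_sections"
    using conj_closed_comp[OF kernel_sections_conj_closed kernel_sections_ac(1) conj_closed_conj[OF kernel_sections_conj_closed kernel_sections_ac(1) Grig_gens(2)]]
    by (simp add: finv_gens)
  then have ac: "grig_a \<circ> grig_c \<in> ?Q"
    using Grig_gens by (auto simp: right_sections_def[of kernel_sections] intro!: Grig_comp bexI[of _ "grig_a \<circ> (grig_b \<circ> grig_a \<circ> grig_b)"])
  have "grig_a \<circ> (grig_a \<circ> grig_c) = grig_c"
    by (auto simp: grig_a_involution)
  then have c: "grig_c \<in> ?Q"
    using conj_closed_comp[OF Q a ac] by simp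
  have "grig_c \<circ> grig_d = grig_b"
    by (auto simp: grig_mult)
  then have b: "grig_b \<in> ?Q"
    using conj_closed_comp[OF Q c d] by simp
  have "grig_a \<circ> grig_a = id"
    by (auto simp: grig_a_involution)
  then have i: "id \<in> ?Q"
    using conj_closed_comp[OF Q a a] by simp
  have "g \<in> ?Q" if "g \<in> Grig" for g
    using that by (induction rule: Grig_induct) (rule a b c i conj_closed_comp[OF Q] | assumption)+
  then show ?thesis
    by (auto simp: right_sections_def)
qed

definition ray_fix :: "(bool list \<Rightarrow> bool list) set"
  where "ray_fix = {g \<in> Grig. \<forall>n. g (ones n) = ones n}"

lemma ray_fix_comp: "f \<in> ray_fix \<Longrightarrow> g \<in> ray_fix \<Longrightarrow> f \<circ> g \<in> ray_fix"
  by (auto simp: ray_fix_def intro: Grig_comp)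

lemma ray_fix_finv: "f \<in> ray_fix \<Longrightarrow> finv f \<in> ray_fix"
  by (auto simp: ray_fix_def intro: Grig_finv) (metis Grig_inv(1))

lemma grig_bcd_ones: "grig_b (ones n) = ones n \<and> grig_c (ones n) = ones n \<and> grig_d (ones n) = ones n"
  by (induction n) auto

lemma left_kernel_ray_fix:
  assumes "x \<in> left_kernel"
  shows "tree_pair x id \<in> ray_fix"
proof -
  have "tree_pair x id (ones n) = ones n" for n by (cases n) auto
  then show ?thesis using assms by (auto simp: left_kernel_def ray_fix_def)
qed

text \<open>
  The first letters of \<open>w\<close> are corrected one at a time: \<open>b\<close> has section \<open>a\<close> at the left vertex, the
  next letter is changed by an element of the left kernel that has section \<open>a\<close> at the right vertex,
  and from then on arbitrary sections are available.
\<close>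

lemma ray_fix_to_ones: "\<exists>s\<in>ray_fix. s (False # w) = False # ones (length w)"
proof -
  have b: "grig_b \<in> ray_fix"
    using Grig_gens grig_bcd_ones by (auto simp: ray_fix_def)
  have 1: "\<exists>s\<in>ray_fix. s (False # True # w) = False # True # ones (length w)" for w
  proof -
    have 2: "\<exists>s\<in>ray_fix. s (False # True # True # w) = False # True # True # ones (length w)" for w
    proof -
      obtain g where g: "g \<in> Grig" "g w = ones (length w)" using Grig_to_ones by blast
      then obtain y where y: "y \<in> kernel_sections" "\<forall>w. y (True # w) = True # g w"
        using right_sections_kernel_sections by (auto simp: right_sections_def[of kernel_sections])
      then obtain x where x: "x \<in> left_kernel" "\<forall>w. x (True # w) = True # y w"
        by (auto simp: right_sections_def[of left_kernel])
      show ?thesis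
        using left_kernel_ray_fix[OF x(1)] x(2) y(2) g(2) by (intro bexI[of _ "tree_pair x id"]) auto
    qed
    show ?thesis
    proof (cases w)
      case Nil
      then show ?thesis using Grig_id by (intro bexI[of _ id]) (auto simp: ray_fix_def)
    next
      case (Cons z v)
      obtain s where s: "s \<in> ray_fix" "s (False # True # True # v) = False # True # True # ones (length v)"
        using 2 by blast
      obtain x where x: "x \<in> left_kernel" "\<forall>w. x (True # w) = True # grig_a w"
        using kernel_sections_ac(1) by (auto simp: right_sections_def[of left_kernel])
      define t where "t = (if z then s else s \<circ> tree_pair x id)"
      have "t \<in> ray_fix"
        unfolding t_def using s(1) ray_fix_comp left_kernel_ray_fix[OF x(1)] by simp
      moreover have "t (False # True # w) = False # True # ones (length w)"
        unfolding t_def Cons using s(2) x(2) by (cases z) simp_all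
      ultimately show ?thesis by blast
    qed
  qed
  show ?thesis
  proof (cases w)
    case Nil
    then show ?thesis using Grig_id by (intro bexI[of _ id]) (auto simp: ray_fix_def)
  next
    case (Cons z v)
    obtain s where s: "s \<in> ray_fix" "s (False # True # v) = False # True # ones (length v)"
      using 1 by blast
    define t where "t = (if z then s else s \<circ> grig_b)"
    have "t \<in> ray_fix"
      unfolding t_def using s(1) ray_fix_comp b by simp
    moreover have "t (False # w) = False # ones (length w)"
      unfolding t_def Cons using s(2) by (cases z) simp_all
    ultimately show ?thesis by blast
  qed
qed

lemma ones_add: "ones (i + n) = ones i @ ones n"
  by (simp add: replicate_add)

lemma ray_fix_transitive:
  assumes "length w = length w'"
  obtains s where "s \<in> Grig" "\<And>n. s (ones n) = ones n"
    "s (ones i @ False # w) = ones i @ False # w'"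
proof -
  obtain f g where f: "f \<in> ray_fix" "f (False # w) = False # ones (length w)"
    and g: "g \<in> ray_fix" "g (False # w') = False # ones (length w')"
    using ray_fix_to_ones by meson
  define t where "t = finv g \<circ> f"
  have t: "t \<in> ray_fix" "t (False # w) = False # w'"
    using f g assms ray_fix_comp ray_fix_finv unfolding t_def
    by (auto simp: ray_fix_def) (metis Grig_inv(1))
  then obtain s where s: "s \<in> Grig" "\<And>w. s (ones i @ w) = ones i @ t w"
    using self_replicating[of t "ones i"] by (auto simp: ray_fix_def)
  have big: "s (ones (i + n)) = ones (i + n)" for n
    using s(2)[of "ones n"] t(1) by (simp add: ray_fix_def ones_add)
  have "s (ones n) = ones n" for n
    using tree_maps_fix_prefix[OF Grig_tree_maps[OF s(1)] big, of "ones n" n]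
    by (simp add: prefix_iff_take min_def)
  then show ?thesis using that s t by metis
qed

section \<open>Rigid stabilisers\<close>

definition rist :: "(bool list \<Rightarrow> bool list) set \<Rightarrow> bool list \<Rightarrow> (bool list \<Rightarrow> bool list) set"
  where "rist L u = {x \<in> L. \<forall>w. \<not> prefix u w \<longrightarrow> x w = w}"

text \<open>
  This makes the group weakly branch.  With \<open>k = (a b)\<^sup>2\<close>, the element \<open>a k a\<close> is inverse to \<open>k\<close>, so
  that \<open>(a k a) (d k d)\<close> is a commutator of \<open>k\<close> with \<open>d = (1, b)\<close>.  It equals \<open>(1, c k c)\<close>, and
  conjugation by \<open>b = (a, c)\<close> removes the \<open>c\<close>.
\<close>

lemma right_copy_mem:
  assumes N: "conj_closed N" and k: "grig_a \<circ> grig_b \<circ> grig_a \<circ> grig_b \<in> N"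
  shows "tree_pair id (grig_a \<circ> grig_b \<circ> grig_a \<circ> grig_b) \<in> N"
proof -
  let ?k = "grig_a \<circ> grig_b \<circ> grig_a \<circ> grig_b"
  let ?x = "grig_b \<circ> ((grig_a \<circ> ?k \<circ> grig_a) \<circ> (grig_d \<circ> ?k \<circ> grig_d)) \<circ> grig_b"
  have "grig_a \<circ> ?k \<circ> grig_a \<in> N" "grig_d \<circ> ?k \<circ> grig_d \<in> N"
    using conj_closed_conj[OF N k Grig_gens(1)] conj_closed_conj[OF N k Grig_gens(4)]
    by (simp_all only: finv_gens)
  from conj_closed_comp[OF N this]
  have "?x \<in> N"
    using conj_closed_conj[OF N _ Grig_gens(2)] by (simp only: finv_gens)
  moreover have "?x w = tree_pair id ?k w" for w
  proof -
    have m: "grig_c (grig_b v) = grig_d v" "grig_d (grig_c v) = grig_b v" "grig_b (grig_d v) = grig_c v" for v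
      by (metis grig_bcd_involution grig_mult)+
    show ?thesis
      by (cases "(id :: bool list \<Rightarrow> bool list, ?k, w)" rule: tree_pair.cases)
        (auto simp: grig_a_involution grig_bcd_involution grig_mult m)
  qed
  ultimately show ?thesis by (metis ext)
qed

text \<open>
  Generalising over \<open>N\<close> makes the induction work: the elements \<open>x\<close> with \<open>(1, x)\<close> in \<open>N\<close> again form a
  normal set containing \<open>(a b)\<^sup>2\<close>.
\<close>

lemma conj_closed_iterate:
  assumes "conj_closed N" "N \<subseteq> Grig" "grig_a \<circ> grig_b \<circ> grig_a \<circ> grig_b \<in> N"
  shows "(tree_pair id ^^ n) (grig_a \<circ> grig_b \<circ> grig_a \<circ> grig_b) \<in> N"
  using assms
proof (induction n arbitrary: N)
  case (Suc n)
  let ?k = "grig_a \<circ> grig_b \<circ> grig_a \<circ> grig_b"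
  define N' where "N' = {x \<in> Grig. tree_pair id x \<in> N}"
  have "conj_closed N'"
    unfolding conj_closed_def
  proof (intro conjI ballI)
    fix x y assume "x \<in> N'" "y \<in> N'"
    moreover have "tree_pair id (x \<circ> y) w = (tree_pair id x \<circ> tree_pair id y) w" for w
      by (cases "(id :: bool list \<Rightarrow> bool list, x, w)" rule: tree_pair.cases) auto
    then have "tree_pair id (x \<circ> y) = tree_pair id x \<circ> tree_pair id y"
      by (rule ext)
    ultimately show "x \<circ> y \<in> N'"
      using Suc.prems(1) by (auto simp: N'_def intro: Grig_comp conj_closed_comp)
  next
    fix x g assume x: "x \<in> N'" and g: "g \<in> Grig"
    obtain h where h: "h \<in> Grig" "\<And>w. h (True # w) = True # g w"
      using self_replicating_letter[OF g] by metis
    obtain k where k: "\<And>w. h (False # w) = False # k w"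
      using Grig_letter_complement[OF h, of False] by auto
    have "(h \<circ> tree_pair id x) w = (tree_pair id (g \<circ> x \<circ> finv g) \<circ> h) w" for w
    proof (cases w)
      case Nil
      then show ?thesis using Grig_length[OF h(1), of "[]"] by simp
    next
      case (Cons y v)
      then show ?thesis using h(2) k g by (cases y) auto
    qed
    from this[of "finv h w" for w]
    have "tree_pair id (g \<circ> x \<circ> finv g) w = (h \<circ> tree_pair id x \<circ> finv h) w" for w
      using Grig_inv(2)[OF h(1)] by simp
    then have "tree_pair id (g \<circ> x \<circ> finv g) = h \<circ> tree_pair id x \<circ> finv h"
      by (rule ext)
    then show "g \<circ> x \<circ> finv g \<in> N'"
      using x g conj_closed_conj[OF Suc.prems(1) _ h(1)] unfolding N'_def
      by (auto intro!: Grig_comp Grig_finv)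
  qed
  moreover have "?k \<in> N'"
    using right_copy_mem[OF Suc.prems(1,3)] Suc.prems(2,3) unfolding N'_def by blast
  moreover have "N' \<subseteq> Grig" by (auto simp: N'_def)
  ultimately have "(tree_pair id ^^ n) ?k \<in> N'"
    by (intro Suc.IH)
  then show ?case unfolding N'_def funpow.simps comp_apply by blast
qed simp

lemma rist_subset: "rist L u \<subseteq> L"
  by (auto simp: rist_def)

lemma rist_memD: "x \<in> rist L u \<Longrightarrow> \<not> prefix u w \<Longrightarrow> x w = w"
  by (auto simp: rist_def)

lemma rist_mono: "prefix u v \<Longrightarrow> rist L v \<subseteq> rist L u"
  by (auto simp: rist_def)

lemma rist_conj:
  assumes "x \<in> rist L u" "g \<in> tree_maps" "g \<circ> x \<circ> finv g \<in> L"
  shows "g \<circ> x \<circ> finv g \<in> rist L (g u)"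
proof -
  have "(g \<circ> x \<circ> finv g) w = w" if "\<not> prefix (g u) w" for w
  proof -
    have "\<not> prefix u (finv g w)"
      using that tree_maps_prefix[OF assms(2), of u "finv g w"] tree_maps_inv(2)[OF assms(2)] by simp
    then show ?thesis using rist_memD[OF assms(1)] tree_maps_inv(2)[OF assms(2)] by simp
  qed
  then show ?thesis using assms(3) by (auto simp: rist_def)
qed

lemma rist_image_prefix:
  assumes "x \<in> rist L u" "L \<subseteq> Grig" "prefix u w"
  shows "prefix u (x w)"
proof (rule ccontr)
  assume "\<not> prefix u (x w)"
  then have "x (x w) = x w" using assms(1) by (rule rist_memD[rotated])
  then have "x w = w" using assms Grig_eq_iff[of x] by (auto simp: rist_def)
  then show False using assms \<open>\<not> prefix u (x w)\<close> by simp
qed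

lemma rist_finv:
  assumes "x \<in> rist L u" "L \<subseteq> Grig" "finv x \<in> L"
  shows "finv x \<in> rist L u"
proof -
  have "x \<in> Grig" using assms by (auto simp: rist_def)
  have "finv x w = w" if "\<not> prefix u w" for w
    using rist_memD[OF assms(1) that] Grig_inv(1)[OF \<open>x \<in> Grig\<close>] by metis
  then show ?thesis using assms(3) by (auto simp: rist_def)
qed

lemma rist_commute:
  assumes "x \<in> rist Grig u" "y \<in> rist Grig v" "length u = length v" "u \<noteq> v"
  shows "x (y w) = y (x w)"
proof -
  have disj: "\<not> prefix v z" if "prefix u z" for z
    using that assms(3,4) by (metis prefix_iff_take)
  consider "prefix u w" | "prefix v w" | "\<not> prefix u w" "\<not> prefix v w" by blast
  then show ?thesis
  proof cases
    case 1
    then show ?thesis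
      using rist_memD[OF assms(2) disj] rist_image_prefix[OF assms(1)] by simp
  next
    case 2
    then have "\<not> prefix u w" "\<not> prefix u (y w)"
      using disj rist_image_prefix[OF assms(2)] by auto
    then show ?thesis
      using rist_memD[OF assms(1)] by simp
  next
    case 3
    then show ?thesis
      using rist_memD[OF assms(1)] rist_memD[OF assms(2)] by simp
  qed
qed

lemma Grig_weakly_branch:
  obtains x w where "x \<in> rist Grig u" "length w = length u + 2" "x w \<noteq> w"
proof -
  let ?n = "length u" and ?k = "grig_a \<circ> grig_b \<circ> grig_a \<circ> grig_b"
  define x where "x = (tree_pair id ^^ ?n) ?k"
  have "?k \<in> Grig" by (intro Grig_comp Grig_gens)
  then have x: "x \<in> Grig"
    using conj_closed_iterate[of Grig] unfolding x_def conj_closed_def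
    by (auto intro: Grig_comp Grig_finv)
  have desc: "(tree_pair id ^^ n) f (ones n @ w) = ones n @ f w" for n f w
    by (induction n) auto
  have other: "(tree_pair id ^^ n) f w = w" if "\<not> prefix (ones n) w" for n f w
    using that
  proof (induction n arbitrary: w)
    case (Suc n)
    then show ?case
      by (cases "(id :: bool list \<Rightarrow> bool list, f, w)" rule: tree_pair.cases) auto
  qed simp
  have "x \<in> rist Grig (ones ?n)"
    using x other by (auto simp: rist_def x_def)
  moreover obtain g where g: "g \<in> Grig" "g (ones ?n) = u"
    using Grig_transitive[of "ones ?n" u] by auto
  ultimately have "g \<circ> x \<circ> finv g \<in> rist Grig u"
    using rist_conj[of x Grig "ones ?n" g] x by (auto intro: Grig_comp Grig_finv Grig_tree_maps)
  moreover define w where "w = ones ?n @ [False, False]"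
  \<comment> \<open>Since \<open>(a b)\<^sup>2\<close> takes \<open>00\<close> to \<open>01\<close>.\<close>
  have "x w \<noteq> w"
    unfolding w_def x_def desc by simp
  then have "(g \<circ> x \<circ> finv g) (g w) \<noteq> g w"
    using g Grig_eq_iff by simp
  moreover have "length (g w) = ?n + 2"
    using g(1) by (simp add: w_def)
  ultimately show ?thesis using that by blast
qed

text \<open>
  An element supported below \<open>u\<close> that moves \<open>w\<close> cannot commute with a nontrivial one supported below
  \<open>w\<close>, as it carries its support elsewhere.
\<close>

lemma rist_noncommuting:
  assumes L: "L \<subseteq> Grig" and nontriv: "\<And>u. \<exists>x\<in>rist L u. x \<noteq> id"
  obtains r s v where "r \<in> rist L u" "s \<in> rist L u" "r (s v) \<noteq> s (r v)"
proof -
  obtain x w where x: "x \<in> rist L u" "x w \<noteq> w"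
    using nontriv by (metis ext id_apply)
  then have "prefix u w" using rist_memD by metis
  obtain r v where r: "r \<in> rist L w" "r v \<noteq> v"
    using nontriv by (metis ext id_apply)
  then have "prefix w v" using rist_memD by metis
  have xG: "x \<in> Grig" using x L by (auto simp: rist_def)
  have "prefix (x w) (x v)" using Grig_prefix[OF xG] \<open>prefix w v\<close> by simp
  then have "\<not> prefix w (x v)"
    using x(2) Grig_length[OF xG] by (metis prefix_iff_take)
  then have "r (x v) = x v" using rist_memD[OF r(1)] by simp
  moreover have "x (r v) \<noteq> x v" using r(2) Grig_eq_iff[OF xG] by simp
  ultimately have "r (x v) \<noteq> x (r v)" by simp
  moreover have "r \<in> rist L u" using r(1) rist_mono[OF \<open>prefix u w\<close>] by blast
  ultimately show ?thesis using that x(1) by blast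
qed

lemma Grig_rist_nontrivial: "\<exists>x\<in>rist Grig u. x \<noteq> id"
  by (rule Grig_weakly_branch[of u]) (auto intro!: bexI)

lemma Grig_finv_comp: "f \<in> Grig \<Longrightarrow> g \<in> Grig \<Longrightarrow> finv (f \<circ> g) = finv g \<circ> finv f"
  using o_inv_distrib tree_mapsD(1) Grig_tree_maps by metis

lemma Grig_finv_finv: "f \<in> Grig \<Longrightarrow> finv (finv f) = f"
  using inv_inv_eq tree_mapsD(1) Grig_tree_maps by metis

text \<open>
  If \<open>y\<close> moves \<open>w\<close>, then \<open>y r y\<^sup>-\<^sup>1\<close> is supported away from \<open>w\<close> and commutes with \<open>r\<close> and \<open>s\<close>, so
  that the double commutator \<open>[[y, r], s]\<close> no longer depends on \<open>y\<close>.
\<close>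

lemma double_commutator:
  assumes y: "y \<in> Grig" "y w \<noteq> w" and r: "r \<in> rist Grig w" and s: "s \<in> rist Grig w"
  defines "t \<equiv> y \<circ> finv (r \<circ> y \<circ> finv r)"
  shows "t \<circ> finv (s \<circ> t \<circ> finv s) = finv r \<circ> s \<circ> r \<circ> finv s"
proof
  fix v
  have rG: "r \<in> Grig" and sG: "s \<in> Grig" using r s by (auto simp: rist_def)
  define p where "p = y \<circ> r \<circ> finv y"
  have pG: "p \<in> Grig" unfolding p_def using y rG by (intro Grig_comp Grig_finv)
  have p: "p \<in> rist Grig (y w)"
    unfolding p_def using r y pG by (intro rist_conj) (auto simp: p_def Grig_tree_maps)
  have p': "finv p \<in> rist Grig (y w)"
    using p pG by (intro rist_finv Grig_finv) auto
  have r': "finv r \<in> rist Grig w"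
    using r rG by (intro rist_finv Grig_finv) auto
  have len: "length w = length (y w)" "w \<noteq> y w" using y by auto
  note com = rist_commute[OF r p' len] rist_commute[OF s p' len] rist_commute[OF r' p' len]
  have t: "t = p \<circ> finv r"
    unfolding t_def p_def using y rG
    by (simp add: Grig_finv_comp Grig_comp Grig_finv Grig_finv_finv comp_assoc)
  have "finv (s \<circ> t \<circ> finv s) = s \<circ> (r \<circ> finv p) \<circ> finv s"
    unfolding t using pG rG sG
    by (simp add: Grig_finv_comp Grig_comp Grig_finv Grig_finv_finv comp_assoc)
  then show "(t \<circ> finv (s \<circ> t \<circ> finv s)) v = (finv r \<circ> s \<circ> r \<circ> finv s) v"
    unfolding t using pG by (simp add: com)
qed

lemma double_commutator_rist:
  assumes L: "L \<subseteq> Grig" and r: "r \<in> rist L w" and s: "s \<in> rist L w" and neq: "r (s v) \<noteq> s (r v)"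
  shows "\<exists>u. (finv r \<circ> s \<circ> r \<circ> finv s) u \<noteq> u"
    and "\<not> prefix w u \<Longrightarrow> (finv r \<circ> s \<circ> r \<circ> finv s) u = u"
proof -
  have rG: "r \<in> Grig" and sG: "s \<in> Grig" using r s L by (auto simp: rist_def)
  have "(finv r \<circ> s \<circ> r \<circ> finv s) (s v) \<noteq> s v"
    using neq rG sG Grig_inv by (metis comp_apply)
  then show "\<exists>u. (finv r \<circ> s \<circ> r \<circ> finv s) u \<noteq> u" by blast
  have fix_inv: "finv x u = u" if "x u = u" "x \<in> Grig" for x u
    using that Grig_inv(1) by metis
  show "(finv r \<circ> s \<circ> r \<circ> finv s) u = u" if "\<not> prefix w u"
    using rist_memD[OF r that] rist_memD[OF s that] rG sG fix_inv by simp
qed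

lemma normal_Grig:
  assumes "L \<lhd> grigorchuk_group"
  shows "L \<subseteq> Grig" "id \<in> L" "x \<in> L \<Longrightarrow> y \<in> L \<Longrightarrow> x \<circ> y \<in> L" "x \<in> L \<Longrightarrow> finv x \<in> L"
    "x \<in> L \<Longrightarrow> g \<in> Grig \<Longrightarrow> g \<circ> x \<circ> finv g \<in> L"
proof -
  have sub: "subgroup L grigorchuk_group" using assms by (rule normal_imp_subgroup)
  show L: "L \<subseteq> Grig" using sub by (rule subgroup.subset)
  show "id \<in> L" using subgroup.one_closed[OF sub] by simp
  show "x \<in> L \<Longrightarrow> y \<in> L \<Longrightarrow> x \<circ> y \<in> L" using subgroup.m_closed[OF sub] by simp
  show "x \<in> L \<Longrightarrow> finv x \<in> L"
    using subgroup.m_inv_closed[OF sub] Grig_m_inv L by (metis subsetD)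
  show "x \<in> L \<Longrightarrow> g \<in> Grig \<Longrightarrow> g \<circ> x \<circ> finv g \<in> L"
    using normal.inv_op_closed2[OF assms] Grig_m_inv by (metis Grig_mult)
qed

text \<open>
  The double commutator of an element of \<open>L\<close> lies in \<open>L\<close> and in a rigid stabiliser; transitivity
  moves it below an arbitrary vertex.
\<close>

lemma normal_rist_nontrivial:
  assumes L: "L \<lhd> grigorchuk_group" and "x \<in> L" "x \<noteq> id"
  shows "\<exists>z\<in>rist L u. z \<noteq> id"
proof -
  note Lf = normal_Grig[OF L]
  obtain w0 where w0: "x w0 \<noteq> w0" using assms(3) by (metis ext id_apply)
  define w where "w = w0 @ ones (length u)"
  define u' where "u' = u @ ones (length w0)"
  have xG: "x \<in> Grig" using Lf assms by auto
  have xw: "x w \<noteq> w"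
    using tree_maps_fix_prefix[OF Grig_tree_maps[OF xG]] w0 unfolding w_def by (metis prefixI)
  obtain r s v where rs: "r \<in> rist Grig w" "s \<in> rist Grig w" "r (s v) \<noteq> s (r v)"
    using rist_noncommuting[OF subset_refl Grig_rist_nontrivial] by metis
  define z where "z = finv r \<circ> s \<circ> r \<circ> finv s"
  have rsG: "r \<in> Grig" "s \<in> Grig" using rs by (auto simp: rist_def)
  define t where "t = x \<circ> finv (r \<circ> x \<circ> finv r)"
  have "t \<in> L" unfolding t_def using Lf assms rsG by (intro Lf)
  then have "t \<circ> finv (s \<circ> t \<circ> finv s) \<in> L" using Lf rsG by (intro Lf)
  then have zL: "z \<in> L"
    using double_commutator[OF xG xw rs(1,2)] by (simp add: t_def z_def)
  moreover have "z \<in> rist L w"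
    using zL double_commutator_rist(2)[OF subset_refl rs] by (auto simp: rist_def z_def)
  moreover obtain q where q: "z q \<noteq> q"
    using double_commutator_rist(1)[OF subset_refl rs] unfolding z_def by blast
  moreover obtain g where g: "g \<in> Grig" "g w = u'"
    using Grig_transitive[of w u'] by (auto simp: w_def u'_def)
  ultimately have "g \<circ> z \<circ> finv g \<in> rist L u'"
    using rist_conj[of z L w g] Lf Grig_tree_maps by simp
  then have "g \<circ> z \<circ> finv g \<in> rist L u"
    using rist_mono[of u u' L] by (auto simp: u'_def)
  moreover have "(g \<circ> z \<circ> finv g) (g q) \<noteq> g q"
    using q g Grig_eq_iff by simp
  ultimately show ?thesis by (metis id_apply)
qed

text \<open>
  With \<open>r\<close> and \<open>s\<close> in the rigid stabiliser of \<open>w\<close> in \<open>L\<close>, the double commutator \<open>[[y, r], s]\<close> is a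
  product of conjugates by \<open>L\<close> of \<open>y\<close> and its inverse, so \<open>x\<close> commutes with it.  It is nontrivial and
  supported below \<open>w\<close>, which therefore has to be fixed by \<open>x\<close>.
\<close>

lemma centraliser_fixes_moved:
  assumes L: "L \<lhd> grigorchuk_group" "\<exists>l\<in>L. l \<noteq> id"
    and N: "N \<subseteq> Grig" "\<And>l n. l \<in> L \<Longrightarrow> n \<in> N \<Longrightarrow> l \<circ> n \<circ> finv l \<in> N"
    and x: "x \<in> Grig" "\<And>n. n \<in> N \<Longrightarrow> x \<circ> n = n \<circ> x"
    and y: "y \<in> N" "y w \<noteq> w"
  shows "x w = w"
proof -
  note Lf = normal_Grig[OF L(1)]
  have yG: "y \<in> Grig" using y N by auto
  have "\<exists>z\<in>rist L u. z \<noteq> id" for u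
    using normal_rist_nontrivial[OF L(1)] L(2) by blast
  then obtain r s v where rs: "r \<in> rist L w" "s \<in> rist L w" "r (s v) \<noteq> s (r v)"
    using rist_noncommuting[OF Lf(1)] by metis
  have rsL: "r \<in> L" "s \<in> L" using rs by (auto simp: rist_def)
  have rsG: "r \<in> Grig" "s \<in> Grig" "r \<in> rist Grig w" "s \<in> rist Grig w"
    using rs Lf(1) by (auto simp: rist_def)
  define C where "C = {n \<in> Grig. x \<circ> n = n \<circ> x}"
  have NC: "N \<subseteq> C" using N(1) x(2) by (auto simp: C_def)
  have Ccomp: "m \<circ> n \<in> C" if "m \<in> C" "n \<in> C" for m n
  proof -
    have "x \<circ> (m \<circ> n) = (m \<circ> n) \<circ> x"
      using that by (auto simp: C_def fun_eq_iff)
    then show ?thesis using that by (auto simp: C_def intro: Grig_comp)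
  qed
  have Cinv: "finv n \<in> C" if "n \<in> C" for n
  proof -
    have nG: "n \<in> Grig" and com: "x (n v) = n (x v)" for v
      using that by (auto simp: C_def fun_eq_iff)
    have "x (finv n v) = finv n (x v)" for v
      using com[of "finv n v"] nG Grig_inv(1)[OF nG, of "x (finv n v)"] by simp
    then show ?thesis using nG by (auto simp: C_def intro: Grig_finv)
  qed
  define t where "t = y \<circ> finv (r \<circ> y \<circ> finv r)"
  have conj: "l \<circ> y \<circ> finv l \<in> C" if "l \<in> L" for l
    using N(2)[OF that y(1)] NC by blast
  have tC: "t \<in> C"
    unfolding t_def using y NC by (intro Ccomp[OF _ Cinv[OF conj[OF rsL(1)]]]) auto
  have "s \<circ> t \<circ> finv s = (s \<circ> y \<circ> finv s) \<circ> finv ((s \<circ> r) \<circ> y \<circ> finv (s \<circ> r))"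
    unfolding t_def using rsG yG
    by (auto simp: Grig_finv_comp Grig_comp Grig_finv Grig_finv_finv)
  also have "\<dots> \<in> C"
    by (rule Ccomp[OF conj[OF rsL(2)] Cinv[OF conj[OF Lf(3)[OF rsL(2,1)]]]])
  finally have "t \<circ> finv (s \<circ> t \<circ> finv s) \<in> C"
    by (rule Ccomp[OF tC Cinv])
  then have zC: "finv r \<circ> s \<circ> r \<circ> finv s \<in> C" (is "?z \<in> C")
    using double_commutator[OF yG y(2) rsG(3,4)] by (simp add: t_def)
  obtain q where q: "?z q \<noteq> q"
    using double_commutator_rist(1)[OF Lf(1) rs] by blast
  then have pq: "prefix w q"
    using double_commutator_rist(2)[OF Lf(1) rs] by blast
  have "x \<circ> ?z = ?z \<circ> x" using zC unfolding C_def by blast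
  from fun_cong[OF this, of q] have "?z (x q) = x (?z q)" by simp
  then have "?z (x q) \<noteq> x q"
    using q Grig_eq_iff[OF x(1)] by simp
  then have "prefix w (x q)"
    using double_commutator_rist(2)[OF Lf(1) rs] by blast
  moreover have "prefix (x w) (x q)"
    using Grig_prefix[OF x(1)] pq by simp
  ultimately show ?thesis
    using Grig_length[OF x(1), of w] by (metis prefix_iff_take)
qed

section \<open>The derived series\<close>

definition level_fix :: "nat \<Rightarrow> (bool list \<Rightarrow> bool list) set"
  where "level_fix n = {g \<in> Grig. \<forall>w. length w = n \<longrightarrow> g w = w}"

lemma level_fix_mono:
  assumes "m \<le> n"
  shows "level_fix n \<subseteq> level_fix m"
proof
  fix g assume g: "g \<in> level_fix n"
  have "g w = w" if "length w = m" for w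
    using tree_maps_eq_upto[of g id n w] g that assms Grig_tree_maps tree_maps_id
    by (auto simp: level_fix_def)
  then show "g \<in> level_fix m" using g by (auto simp: level_fix_def)
qed

text \<open>
  On the pair of children of a fixed vertex every element acts as an element of the symmetric group
  on two letters, which is commutative.
\<close>

lemma derived_level_fix:
  assumes "L \<subseteq> level_fix n"
  shows "derived grigorchuk_group L \<subseteq> level_fix (Suc n)"
proof -
  interpret G: group grigorchuk_group by (rule group_grigorchuk_group)
  have sub: "subgroup (level_fix (Suc n)) grigorchuk_group"
  proof (rule G.subgroupI)
    show "level_fix (Suc n) \<noteq> {}" using Grig_id by (auto simp: level_fix_def)
    fix f g assume f: "f \<in> level_fix (Suc n)" and g: "g \<in> level_fix (Suc n)"
    show "f \<otimes>\<^bsub>grigorchuk_group\<^esub> g \<in> level_fix (Suc n)"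
      using f g by (auto simp: level_fix_def intro: Grig_comp)
    have "f \<in> Grig" using f by (auto simp: level_fix_def)
    have "finv f w = w" if "length w = Suc n" for w
      using f that Grig_inv(1)[OF \<open>f \<in> Grig\<close>, of w] by (auto simp: level_fix_def)
    then show "inv\<^bsub>grigorchuk_group\<^esub> f \<in> level_fix (Suc n)"
      using \<open>f \<in> Grig\<close> by (auto simp: Grig_m_inv level_fix_def intro: Grig_finv)
  qed (auto simp: level_fix_def)
  have "f (g w) = g (f w)" if f: "f \<in> level_fix n" and g: "g \<in> level_fix n" and len: "length w = Suc n" for f g w
  proof -
    obtain v x where w: "w = v @ [x]" "length v = n"
      using len by (cases w rule: rev_cases) auto
    have fv: "f \<in> tree_maps" "f v = v" and gv: "g \<in> tree_maps" "g v = v"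
      using f g w(2) Grig_tree_maps by (auto simp: level_fix_def)
    obtain e d where "\<forall>x. f (v @ [x]) = v @ [e \<noteq> x]" "\<forall>x. g (v @ [x]) = v @ [d \<noteq> x]"
      using tree_maps_children[OF fv] tree_maps_children[OF gv] by blast
    then show ?thesis unfolding w by auto
  qed
  note commute = this
  have com: "(f \<circ> g \<circ> finv f \<circ> finv g) w = w" if "f \<in> L" "g \<in> L" "length w = Suc n" for f g w
  proof -
    have fg: "f \<in> level_fix n" "g \<in> level_fix n" "f \<in> Grig" "g \<in> Grig"
      using that assms by (auto simp: level_fix_def)
    have "f (g (finv f (finv g w))) = g (f (finv f (finv g w)))"
      using fg that by (intro commute) (simp_all add: Grig_finv)
    then show ?thesis using fg by simp
  qed
  have "derived_set grigorchuk_group L \<subseteq> level_fix (Suc n)"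
  proof (safe)
    fix f g assume "f \<in> L" "g \<in> L"
    then have "f \<in> Grig" "g \<in> Grig" using assms by (auto simp: level_fix_def)
    then have "f \<circ> g \<circ> finv f \<circ> finv g \<in> Grig" by (intro Grig_comp Grig_finv)
    with com[OF \<open>f \<in> L\<close> \<open>g \<in> L\<close>]
    show "f \<otimes>\<^bsub>grigorchuk_group\<^esub> g \<otimes>\<^bsub>grigorchuk_group\<^esub> inv\<^bsub>grigorchuk_group\<^esub> f \<otimes>\<^bsub>grigorchuk_group\<^esub> inv\<^bsub>grigorchuk_group\<^esub> g
        \<in> level_fix (Suc n)"
      using \<open>f \<in> Grig\<close> \<open>g \<in> Grig\<close> by (simp add: Grig_m_inv level_fix_def)
  qed
  then show ?thesis
    unfolding derived_def using G.generate_subgroup_incl[OF _ sub] by blast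
qed

lemma derived_nontrivial:
  assumes L: "L \<lhd> grigorchuk_group" "\<exists>l\<in>L. l \<noteq> id"
  shows "\<exists>l\<in>derived grigorchuk_group L. l \<noteq> id"
proof -
  note Lf = normal_Grig[OF L(1)]
  have "\<exists>z\<in>rist L u. z \<noteq> id" for u
    using normal_rist_nontrivial[OF L(1)] L(2) by blast
  then obtain r s v where rs: "r \<in> rist L []" "s \<in> rist L []" "r (s v) \<noteq> s (r v)"
    using rist_noncommuting[OF Lf(1)] by metis
  have rsL: "r \<in> L" "s \<in> L" "r \<in> Grig" "s \<in> Grig" using rs Lf(1) by (auto simp: rist_def)
  have "r \<circ> s \<circ> finv r \<circ> finv s
      = r \<otimes>\<^bsub>grigorchuk_group\<^esub> s \<otimes>\<^bsub>grigorchuk_group\<^esub> inv\<^bsub>grigorchuk_group\<^esub> r \<otimes>\<^bsub>grigorchuk_group\<^esub> inv\<^bsub>grigorchuk_group\<^esub> s"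
    using rsL by (simp add: Grig_m_inv)
  then have "r \<circ> s \<circ> finv r \<circ> finv s \<in> derived_set grigorchuk_group L"
    using rsL by blast
  then have "r \<circ> s \<circ> finv r \<circ> finv s \<in> derived grigorchuk_group L"
    unfolding derived_def by (rule generate.incl)
  moreover have "(r \<circ> s \<circ> finv r \<circ> finv s) (s (r v)) \<noteq> s (r v)"
    using rs(3) rsL by simp
  ultimately show ?thesis by (metis id_apply)
qed

definition derived_step :: "nat \<Rightarrow> (bool list \<Rightarrow> bool list) set"
  where "derived_step n = (derived grigorchuk_group ^^ n) Grig"

lemma derived_step:
  shows "derived_step n \<lhd> grigorchuk_group" "\<exists>l\<in>derived_step n. l \<noteq> id" "derived_step n \<subseteq> level_fix n"
proof -
  interpret G: group grigorchuk_group by (rule group_grigorchuk_group)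
  show *: "derived_step n \<lhd> grigorchuk_group" for n
    unfolding derived_step_def by (induction n) (auto intro: G.normal_self G.derived_is_normal)
  show "\<exists>l\<in>derived_step n. l \<noteq> id"
  proof (induction n)
    case 0
    show ?case
      using Grig_rist_nontrivial[of "[]"] rist_subset by (fastforce simp: derived_step_def)
  next
    case (Suc n)
    then show ?case
      using derived_nontrivial[OF *[of n]] unfolding derived_step_def funpow.simps comp_apply by blast
  qed
  show "derived_step n \<subseteq> level_fix n"
  proof (induction n)
    case 0
    have "g [] = []" if "g \<in> Grig" for g using Grig_length[OF that, of "[]"] by simp
    then show ?case by (auto simp: derived_step_def level_fix_def)
  next
    case (Suc n)
    then show ?case using derived_level_fix by (simp add: derived_step_def)
  qed
qed

text \<open>
  Up to conjugation, \<open>v = 1\<^sup>l\<close> and \<open>L\<close> contains \<open>g\<close> swapping its two children.  The vertices \<open>g(1\<^sup>n)\<close> and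
  \<open>1\<^sup>l0z\<close> are related by an element \<open>s\<close> of the stabiliser of \<open>1\<^sup>n\<close>, for every \<open>z\<close>, and \<open>s g s\<^sup>-\<^sup>1\<close>
  takes \<open>1\<^sup>n\<close> to the latter.  The vertices below \<open>1\<^sup>l1\<close> are reached by applying \<open>g\<^sup>-\<^sup>1\<close> afterwards.
\<close>

lemma normal_subtree_transitive:
  assumes L: "L \<lhd> grigorchuk_group" "L \<subseteq> level_fix l" "x \<in> L" "length p = Suc l" "x p \<noteq> p"
    and w: "prefix v w" "prefix v w'" "length v = l" "length w = length w'"
  shows "\<exists>y\<in>L. y w = w'"
proof -
  note Lf = normal_Grig[OF L(1)]
  define n where "n = length w"
  have nl: "l \<le> n" using w prefix_length_le by (auto simp: n_def)
  have ones: "\<exists>y\<in>L. y (ones n) = u" if u: "prefix (ones l) u" "length u = n" for u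
  proof (cases "n = l")
    case True
    then have "u = ones n" using u by (metis prefix_iff_take length_replicate take_all_iff order_refl)
    then show ?thesis using Lf(2) by (intro bexI[of _ id]) auto
  next
    case False
    then obtain m where m: "n = Suc (l + m)" using nl by (metis less_natE le_neq_implies_less)
    \<comment> \<open>A conjugate of \<open>x\<close> moves \<open>1\<^sup>l1\<close>; since it fixes \<open>1\<^sup>l\<close>, it swaps the two children.\<close>
    obtain h where h: "h \<in> Grig" "h p = ones (Suc l)"
      using Grig_transitive[of p "ones (Suc l)"] L(4) by auto
    define g where "g = h \<circ> x \<circ> finv h"
    have gL: "g \<in> L" unfolding g_def using Lf h L(3) by simp
    then have gG: "g \<in> Grig" using Lf(1) by auto
    have gm: "g (ones (Suc l)) \<noteq> ones (Suc l)"
      using L(5) Grig_eq_iff[OF h(1), of "x p" p] Grig_inv(1)[OF h(1), of p] h(2) by (simp add: g_def)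
    have gl: "g (ones l) = ones l" using gL L(2) by (auto simp: level_fix_def)
    obtain e where e: "\<And>x. g (ones l @ [x]) = ones l @ [e \<noteq> x]"
      using tree_maps_children[OF Grig_tree_maps[OF gG] gl] by blast
    have "e"
    proof (rule ccontr)
      assume "\<not> e"
      then have "g (ones l @ [True]) = ones l @ [True]" using e[of True] by simp
      then show False using gm by (simp add: replicate_append_same)
    qed
    have sw: "\<exists>z'. g (ones l @ b # z) = ones l @ (\<not> b) # z' \<and> length z' = length z" for b z
    proof -
      have "take (Suc l) (g (ones l @ b # z)) = ones l @ [\<not> b]"
        using Grig_take[OF gG, of "Suc l" "ones l @ b # z"] e[of b] \<open>e\<close> by simp
      then have "g (ones l @ b # z) = (ones l @ [\<not> b]) @ drop (Suc l) (g (ones l @ b # z))"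
        by (metis append_take_drop_id)
      then show ?thesis using gG by (intro exI[of _ "drop (Suc l) (g (ones l @ b # z))"]) auto
    qed
    have False_case: "\<exists>y\<in>L. y (ones n) = ones l @ False # z" if lz: "length z = m" for z
    proof -
      have on: "ones n = ones l @ True # ones m"
        using ones_add[of l "Suc m"] m by simp
      obtain z' where z': "g (ones n) = ones l @ False # z'" "length z' = m"
        using sw[of True "ones m"] on by auto
      obtain s where s: "s \<in> Grig" "\<And>n. s (ones n) = ones n" "s (ones l @ False # z') = ones l @ False # z"
        by (rule ray_fix_transitive[of z' z l]) (use z' lz in auto)
      have "finv s (ones n) = ones n" using s Grig_inv(1) by metis
      then have "(s \<circ> g \<circ> finv s) (ones n) = ones l @ False # z"
        using s(3) z' by simp
      moreover have "s \<circ> g \<circ> finv s \<in> L" using Lf gL s by simp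
      ultimately show ?thesis by blast
    qed
    obtain y where y: "u = ones l @ y" using u(1) by (auto simp: prefix_def)
    then obtain b z where "y = b # z" using u(2) m by (cases y) auto
    then have u: "u = ones l @ b # z" "length z = m" using u(2) y m by auto
    show ?thesis
    proof (cases b)
      case False
      then show ?thesis using False_case u by simp
    next
      case True
      obtain z' where z': "g u = ones l @ False # z'" "length z' = m"
        using sw[of True z] u True by auto
      then obtain y where y: "y \<in> L" "y (ones n) = g u" using False_case by metis
      then have "(finv g \<circ> y) (ones n) = u" using gG by simp
      moreover have "finv g \<circ> y \<in> L" using Lf gL y by simp
      ultimately show ?thesis by blast
    qed
  qed
  obtain h where h: "h \<in> Grig" "h v = ones l"
    using Grig_transitive[of v "ones l"] w by auto
  have "prefix (ones l) (h w)" "prefix (ones l) (h w')"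
    using Grig_prefix[OF h(1)] w h(2) by metis+
  then obtain y y' where y: "y \<in> L" "y (ones n) = h w" "y' \<in> L" "y' (ones n) = h w'"
    using ones[of "h w"] ones[of "h w'"] w h(1) by (auto simp: n_def)
  define f where "f = finv h \<circ> (y' \<circ> finv y) \<circ> finv (finv h)"
  have "f \<in> L" unfolding f_def using y h by (intro Lf Grig_finv)
  moreover have "f w = w'"
    unfolding f_def using y h Lf(1) Grig_inv(1)[of y "ones n"] Grig_inv(1)[of h w']
    by (auto simp: Grig_finv_finv)
  ultimately show ?thesis by blast
qed

text \<open>
  Nontriviality bounds the levels fixed by a term of the derived series, so there is a deepest one.
\<close>

lemma deep_level:
  obtains l x p where "n \<le> l" "derived_step n \<subseteq> level_fix l" "x \<in> derived_step n" "length p = Suc l" "x p \<noteq> p"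
proof -
  note D = derived_step[of n]
  obtain x w where x: "x \<in> derived_step n" "x w \<noteq> w"
    using D(2) by (metis ext id_apply)
  define k where "k = (LEAST k. \<not> derived_step n \<subseteq> level_fix k)"
  have "\<not> derived_step n \<subseteq> level_fix (length w)"
    using x by (auto simp: level_fix_def)
  then have k: "\<not> derived_step n \<subseteq> level_fix k" unfolding k_def by (rule LeastI)
  have less: "derived_step n \<subseteq> level_fix j" if "j < k" for j
    using that not_less_Least unfolding k_def by blast
  have "n < k" using k D(3) level_fix_mono by (meson not_le order_trans)
  then obtain l where l: "k = Suc l" "n \<le> l" by (metis less_natE le_add1 less_eq_Suc_le Suc_le_D Suc_le_mono)
  obtain y where "y \<in> derived_step n" "y \<notin> level_fix (Suc l)" using k l by blast
  then obtain p where "length p = Suc l" "y p \<noteq> p"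
    using normal_Grig(1)[OF D(1)] by (auto simp: level_fix_def)
  then show ?thesis using that l less[of l] \<open>y \<in> derived_step n\<close> by simp
qed

section \<open>Automorphisms permute the vertices of a level\<close>

definition centraliser :: "(bool list \<Rightarrow> bool list) set \<Rightarrow> (bool list \<Rightarrow> bool list) set"
  where "centraliser N = {x \<in> Grig. \<forall>n\<in>N. x \<circ> n = n \<circ> x}"

definition fixator :: "bool list \<Rightarrow> (bool list \<Rightarrow> bool list) set"
  where "fixator v = {x \<in> Grig. \<forall>w. prefix v w \<longrightarrow> x w = w}"

definition normalised :: "(bool list \<Rightarrow> bool list) set \<Rightarrow> (bool list \<Rightarrow> bool list) set \<Rightarrow> bool"
  where "normalised L N \<longleftrightarrow> N \<subseteq> Grig \<and> (\<exists>n\<in>N. n \<noteq> id) \<and> (\<forall>l\<in>L. \<forall>n\<in>N. l \<circ> n \<circ> finv l \<in> N)"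

text \<open>
  Each vertex \<open>w\<close> below \<open>v\<close> is determined by the support of some element of its rigid stabiliser,
  and this support is preserved by whatever commutes with the element.
\<close>

lemma centraliser_rist: "centraliser (rist Grig v) = fixator v"
proof
  show "centraliser (rist Grig v) \<subseteq> fixator v"
  proof
    fix x assume x: "x \<in> centraliser (rist Grig v)"
    then have xG: "x \<in> Grig" by (simp add: centraliser_def)
    have "x w = w" if "prefix v w" for w
    proof -
      obtain z q where z: "z \<in> rist Grig w" "z q \<noteq> q"
        by (rule Grig_weakly_branch[of w])
      then have "prefix w q" using rist_memD by metis
      have "z \<in> rist Grig v" using z rist_mono[OF that] by blast
      then have "x \<circ> z = z \<circ> x" using x by (simp add: centraliser_def)
      from fun_cong[OF this, of q] have "z (x q) = x (z q)" by simp
      then have "z (x q) \<noteq> x q" using z(2) Grig_eq_iff[OF xG] by simp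
      then have "prefix w (x q)" using rist_memD[OF z(1)] by blast
      moreover have "prefix (x w) (x q)" using Grig_prefix[OF xG] \<open>prefix w q\<close> by simp
      ultimately show ?thesis using Grig_length[OF xG, of w] by (metis prefix_iff_take)
    qed
    then show "x \<in> fixator v" using xG by (simp add: fixator_def)
  qed
  show "fixator v \<subseteq> centraliser (rist Grig v)"
  proof
    fix x assume x: "x \<in> fixator v"
    then have xG: "x \<in> Grig" by (simp add: fixator_def)
    have "x (n w) = n (x w)" if n: "n \<in> rist Grig v" for n w
    proof (cases "prefix v w")
      case True
      then show ?thesis
        using x rist_image_prefix[OF n subset_refl True] by (simp add: fixator_def)
    next
      case False
      have "\<not> prefix v (x w)"
      proof
        assume p: "prefix v (x w)"
        then have "x (x w) = x w" using x by (simp add: fixator_def)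
        then have "x w = w" using Grig_eq_iff[OF xG] by simp
        then show False using p False by simp
      qed
      then show ?thesis using False rist_memD[OF n] by simp
    qed
    then show "x \<in> centraliser (rist Grig v)"
      using xG by (auto simp: centraliser_def fun_eq_iff)
  qed
qed

lemma fixator_incomparable:
  assumes "fixator v \<subseteq> fixator v'" "length v = length v'"
  shows "v = v'"
proof (rule ccontr)
  assume "v \<noteq> v'"
  obtain z q where z: "z \<in> rist Grig v'" "z q \<noteq> q"
    by (rule Grig_weakly_branch[of v'])
  have "\<not> prefix v' w" if "prefix v w" for w
    using that assms(2) \<open>v \<noteq> v'\<close> by (metis prefix_iff_take)
  then have "z \<in> fixator v"
    using z(1) rist_memD[OF z(1)] unfolding fixator_def rist_def by blast
  moreover have "prefix v' q" using rist_memD[OF z(1)] z(2) by metis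
  ultimately show False using assms(1) z(2) by (auto simp: fixator_def)
qed

lemma fixator_conj:
  assumes g: "g \<in> Grig"
  shows "fixator (g v) = (\<lambda>x. g \<circ> x \<circ> finv g) ` fixator v"
proof -
  have incl: "(\<lambda>x. h \<circ> x \<circ> finv h) ` fixator u \<subseteq> fixator (h u)" if h: "h \<in> Grig" for h u
  proof clarify
    fix x assume x: "x \<in> fixator u"
    have "(h \<circ> x \<circ> finv h) w = w" if "prefix (h u) w" for w
    proof -
      have "prefix u (finv h w)"
        using that Grig_prefix[OF h, of u "finv h w"] h by simp
      then show ?thesis using x h by (simp add: fixator_def)
    qed
    then show "h \<circ> x \<circ> finv h \<in> fixator (h u)"
      using x h by (auto simp: fixator_def intro!: Grig_comp Grig_finv)
  qed
  show ?thesis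
  proof
    show "(\<lambda>x. g \<circ> x \<circ> finv g) ` fixator v \<subseteq> fixator (g v)" by (rule incl[OF g])
    show "fixator (g v) \<subseteq> (\<lambda>x. g \<circ> x \<circ> finv g) ` fixator v"
    proof
      fix y assume "y \<in> fixator (g v)"
      then have "finv g \<circ> y \<circ> finv (finv g) \<in> fixator v"
        using incl[OF Grig_finv[OF g], of "g v"] g by auto
      moreover have "y = g \<circ> (finv g \<circ> y \<circ> finv (finv g)) \<circ> finv g"
        using g by (auto simp: fun_eq_iff Grig_finv_finv)
      ultimately show "y \<in> (\<lambda>x. g \<circ> x \<circ> finv g) ` fixator v" by blast
    qed
  qed
qed

lemma normalised_rist:
  assumes "L \<subseteq> level_fix l" "length v = l"
  shows "normalised L (rist Grig v)"
proof -
  have "g \<circ> x \<circ> finv g \<in> rist Grig v" if "g \<in> L" "x \<in> rist Grig v" for g x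
  proof -
    have g: "g \<in> Grig" "g v = v" using that assms by (auto simp: level_fix_def)
    have "g \<circ> x \<circ> finv g \<in> Grig"
      using g that rist_subset by (blast intro: Grig_comp Grig_finv)
    then show ?thesis using rist_conj[OF that(2) Grig_tree_maps[OF g(1)]] g(2) by simp
  qed
  then show ?thesis
    unfolding normalised_def using rist_subset Grig_rist_nontrivial by blast
qed

text \<open>
  If some element of \<open>N\<close> moves a vertex below \<open>v\<close>, then, by transitivity of \<open>L\<close> on the levels of the
  subtree and because \<open>L\<close> normalises \<open>N\<close>, every sufficiently deep vertex below \<open>v\<close> is moved.
\<close>

lemma centraliser_normalised_le:
  assumes L: "L \<lhd> grigorchuk_group" "L \<subseteq> level_fix l" "x \<in> L" "length p = Suc l" "x p \<noteq> p"
    and N: "normalised L N"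
  shows "\<exists>v. length v = l \<and> centraliser N \<subseteq> fixator v"
proof -
  note Lf = normal_Grig[OF L(1)]
  have Lne: "\<exists>l\<in>L. l \<noteq> id" using L(3,5) by (metis id_apply)
  have NG: "N \<subseteq> Grig" and Nc: "\<And>l n. l \<in> L \<Longrightarrow> n \<in> N \<Longrightarrow> l \<circ> n \<circ> finv l \<in> N"
    using N by (auto simp: normalised_def)
  obtain y w0 where y: "y \<in> N" "y w0 \<noteq> w0"
    using N unfolding normalised_def by (metis ext id_apply)
  have yG: "y \<in> Grig" using y NG by auto
  have deep: "y (w0 @ z) \<noteq> w0 @ z" for z
    using tree_maps_fix_prefix[OF Grig_tree_maps[OF yG]] y(2) by (metis prefixI)
  \<comment> \<open>Padding a moved vertex ensures that it has a prefix on level \<open>l\<close>.\<close>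
  define w1 where "w1 = w0 @ ones l"
  define v where "v = take l w1"
  have v: "length v = l" "prefix v w1"
    unfolding v_def by (simp add: w1_def, rule take_is_prefix)
  have "centraliser N \<subseteq> fixator v"
  proof
    fix c assume c: "c \<in> centraliser N"
    then have cG: "c \<in> Grig" and cN: "\<And>n. n \<in> N \<Longrightarrow> c \<circ> n = n \<circ> c"
      by (auto simp: centraliser_def)
    have "c w = w" if w: "prefix v w" for w
    proof -
      define w' where "w' = w @ ones (length w1)"
      define w2 where "w2 = w1 @ ones (length w)"
      have "prefix v w2" "prefix v w'" "length w2 = length w'"
        using v w by (auto simp: w2_def w'_def)
      then obtain g where g: "g \<in> L" "g w2 = w'"
        using normal_subtree_transitive[OF L _ _ v(1)] by blast
      have gG: "g \<in> Grig" using g Lf(1) by auto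
      have "y w2 \<noteq> w2" using deep by (simp add: w2_def w1_def)
      then have "(g \<circ> y \<circ> finv g) w' \<noteq> w'"
        using g(2) gG Grig_inv(1)[OF gG, of w2] Grig_eq_iff[OF gG] by auto
      then have "c w' = w'"
        using centraliser_fixes_moved[OF L(1) Lne NG Nc cG cN Nc[OF g(1) y(1)]] by blast
      then show ?thesis
        using tree_maps_fix_prefix[OF Grig_tree_maps[OF cG]] unfolding w'_def by (metis prefixI)
    qed
    then show "c \<in> fixator v" using cG by (simp add: fixator_def)
  qed
  then show ?thesis using v(1) by blast
qed

lemma Grig_isoD:
  assumes "\<phi> \<in> iso grigorchuk_group grigorchuk_group"
  shows "f \<in> Grig \<Longrightarrow> g \<in> Grig \<Longrightarrow> \<phi> (f \<circ> g) = \<phi> f \<circ> \<phi> g"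
    "\<phi> ` Grig = Grig" "inj_on \<phi> Grig" "f \<in> Grig \<Longrightarrow> \<phi> (finv f) = finv (\<phi> f)"
    "f \<in> Grig \<Longrightarrow> \<phi> f \<in> Grig" "\<phi> id = id"
proof -
  interpret G: group grigorchuk_group by (rule group_grigorchuk_group)
  have hom: "\<phi> \<in> hom grigorchuk_group grigorchuk_group" and bij: "bij_betw \<phi> Grig Grig"
    using assms by (auto simp: iso_def)
  interpret group_hom grigorchuk_group grigorchuk_group \<phi>
    using hom by unfold_locales
  show "f \<in> Grig \<Longrightarrow> g \<in> Grig \<Longrightarrow> \<phi> (f \<circ> g) = \<phi> f \<circ> \<phi> g"
    using hom_mult by (metis Grig_mult)
  show "\<phi> ` Grig = Grig" "inj_on \<phi> Grig" using bij by (auto simp: bij_betw_def)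
  show cl: "f \<in> Grig \<Longrightarrow> \<phi> f \<in> Grig" for f by (rule hom_closed)
  show "f \<in> Grig \<Longrightarrow> \<phi> (finv f) = finv (\<phi> f)"
    using hom_inv cl by (metis Grig_m_inv)
  show "\<phi> id = id" using hom_one by (metis Grig_one)
qed

lemma iso_derived_step:
  assumes "\<phi> \<in> iso grigorchuk_group grigorchuk_group"
  shows "\<phi> ` derived_step n = derived_step n"
proof -
  interpret G: group grigorchuk_group by (rule group_grigorchuk_group)
  interpret group_hom grigorchuk_group grigorchuk_group \<phi>
    using assms by unfold_locales (auto simp: iso_def)
  show ?thesis
    unfolding derived_step_def
    using exp_of_derived_img[OF subset_refl, of n] Grig_isoD(2)[OF assms] by metis
qed

lemma iso_centraliser:
  assumes iso: "\<phi> \<in> iso grigorchuk_group grigorchuk_group" and N: "N \<subseteq> Grig"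
  shows "\<phi> ` centraliser N = centraliser (\<phi> ` N)"
proof -
  note I = Grig_isoD[OF iso]
  have com: "\<phi> x \<circ> \<phi> n = \<phi> n \<circ> \<phi> x \<longleftrightarrow> x \<circ> n = n \<circ> x" if "x \<in> Grig" "n \<in> Grig" for x n
    using that I(1) inj_onD[OF I(3)] Grig_comp by metis
  show ?thesis
  proof
    show "\<phi> ` centraliser N \<subseteq> centraliser (\<phi> ` N)"
      using com N I(5) by (auto simp: centraliser_def)
    show "centraliser (\<phi> ` N) \<subseteq> \<phi> ` centraliser N"
    proof
      fix y assume y: "y \<in> centraliser (\<phi> ` N)"
      then obtain x where x: "x \<in> Grig" "y = \<phi> x" using I(2) by (auto simp: centraliser_def)
      then have "x \<in> centraliser N"
        using y com N unfolding centraliser_def by blast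
      then show "y \<in> \<phi> ` centraliser N" using x by blast
    qed
  qed
qed

lemma iso_normalised:
  assumes iso: "\<phi> \<in> iso grigorchuk_group grigorchuk_group" and L: "\<phi> ` L = L" "L \<subseteq> Grig"
    and N: "normalised L N"
  shows "normalised L (\<phi> ` N)"
proof -
  note I = Grig_isoD[OF iso]
  have NG: "N \<subseteq> Grig" using N by (simp add: normalised_def)
  obtain n where n: "n \<in> N" "n \<noteq> id" using N by (auto simp: normalised_def)
  have "\<phi> n \<noteq> id"
    using n NG Grig_id inj_onD[OF I(3), of n id] I(6) by auto
  moreover have "g \<circ> m \<circ> finv g \<in> \<phi> ` N" if gm: "g \<in> L" "m \<in> \<phi> ` N" for g m
  proof -
    obtain h k where h: "h \<in> L" "g = \<phi> h" and k: "k \<in> N" "m = \<phi> k" using gm L(1) by blast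
    have hk: "h \<in> Grig" "k \<in> Grig" using h k L NG by auto
    then have "g \<circ> m \<circ> finv g = \<phi> (h \<circ> k \<circ> finv h)"
      using h k I(1,4) by (simp add: Grig_comp Grig_finv)
    moreover have "h \<circ> k \<circ> finv h \<in> N" using N h k by (simp add: normalised_def)
    ultimately show ?thesis by blast
  qed
  ultimately show ?thesis
    unfolding normalised_def using n I(5) NG by blast
qed

text \<open>
  The fixators of the vertices of level \<open>l\<close> are the maximal centralisers of nontrivial sets
  normalised by the term of the derived series.  This characterisation transfers along \<open>\<phi>\<close> and its
  inverse, and as distinct fixators are incomparable, the two resulting inclusions are equalities.
\<close>

lemma iso_fixator:
  assumes iso: "\<phi> \<in> iso grigorchuk_group grigorchuk_group"
    and l: "derived_step n \<subseteq> level_fix l" "x \<in> derived_step n" "length p = Suc l" "x p \<noteq> p"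
    and v: "length v = l"
  shows "\<exists>v'. length v' = l \<and> \<phi> ` fixator v = fixator v'"
proof -
  let ?L = "derived_step n"
  note LN = derived_step(1)[of n]
  have into: "\<exists>v'. length v' = l \<and> \<theta> ` fixator u \<subseteq> fixator v'"
    if \<theta>: "\<theta> \<in> iso grigorchuk_group grigorchuk_group" and u: "length u = l" for \<theta> u
  proof -
    have "normalised ?L (\<theta> ` rist Grig u)"
      using iso_normalised[OF \<theta> iso_derived_step[OF \<theta>] normal_Grig(1)[OF LN] normalised_rist[OF l(1) u]] .
    then show ?thesis
      using centraliser_normalised_le[OF LN l] iso_centraliser[OF \<theta> rist_subset, of u]
      by (simp add: centraliser_rist)
  qed
  define \<psi> where "\<psi> = inv_into Grig \<phi>"
  have \<psi>: "\<psi> \<in> iso grigorchuk_group grigorchuk_group"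
    unfolding \<psi>_def using group.iso_set_sym[OF group_grigorchuk_group iso] .
  note I = Grig_isoD[OF iso]
  have \<psi>\<phi>: "\<psi> ` \<phi> ` S = S" and \<phi>\<psi>: "\<phi> ` \<psi> ` S = S" if "S \<subseteq> Grig" for S
    using that I(2,3) unfolding \<psi>_def
    by (auto simp: image_image inv_into_f_f f_inv_into_f subset_iff intro!: image_eqI)
  have fG: "fixator u \<subseteq> Grig" for u by (auto simp: fixator_def)
  obtain v' where v': "length v' = l" "\<phi> ` fixator v \<subseteq> fixator v'" using into[OF iso v] by blast
  obtain v'' where v'': "length v'' = l" "\<psi> ` fixator v' \<subseteq> fixator v''" using into[OF \<psi> v'(1)] by blast
  have "fixator v \<subseteq> fixator v''"
    using image_mono[OF v'(2), of \<psi>] v''(2) \<psi>\<phi>[OF fG] by simp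
  then have "v = v''" using fixator_incomparable v v'' by simp
  then have "fixator v' \<subseteq> \<phi> ` fixator v"
    using image_mono[OF v''(2), of \<phi>] \<phi>\<psi>[OF fG] by simp
  then show ?thesis using v' by blast
qed

section \<open>The permutation of a level preserves the tree structure\<close>

lemma ones_or_False: "w = ones (length w) \<or> (\<exists>i w'. w = ones i @ False # w')"
proof (induction w)
  case (Cons x w)
  show ?case
  proof (cases x)
    case True
    from Cons.IH show ?thesis
    proof
      assume "w = ones (length w)"
      then show ?thesis using True by simp
    next
      assume "\<exists>i w'. w = ones i @ False # w'"
      then obtain i w' where "w = ones i @ False # w'" by blast
      then have "x # w = ones (Suc i) @ False # w'" using True by simp
      then show ?thesis by blast
    qed
  next
    case False
    then have "x # w = ones 0 @ False # w" by simp
    then show ?thesis by blast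
  qed
qed simp

text \<open>
  Siblings are recognised by the permutation action on their level alone.  For two vertices that are
  not siblings take \<open>v = 1\<^sup>k\<^sup>+\<^sup>1\<close> and \<open>w = 1\<^sup>i0w'\<close> with \<open>w'\<close> nonempty: an element with section
  \<open>b = (a, c)\<close> at \<open>1\<^sup>i\<close> fixes \<open>v\<close> and changes the first letter of \<open>w'\<close>.
\<close>

lemma sibling_iff_stabiliser:
  assumes len: "length v = Suc k" "length w = Suc k"
  shows "take k v = take k w \<longleftrightarrow> (\<forall>g\<in>Grig. g v = v \<longrightarrow> g w = w)"
proof
  assume eq: "take k v = take k w"
  obtain u x where v: "v = u @ [x]" "length u = k" using len by (cases v rule: rev_cases) auto
  obtain y where w: "w = u @ [y]" using len eq v by (cases w rule: rev_cases) auto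
  show "\<forall>g\<in>Grig. g v = v \<longrightarrow> g w = w"
  proof (intro ballI impI)
    fix g assume g: "g \<in> Grig" "g v = v"
    have "g u = u"
      using tree_maps_fix_prefix[OF Grig_tree_maps[OF g(1)] g(2), of u] v by simp
    then obtain e where "\<forall>x. g (u @ [x]) = u @ [e \<noteq> x]"
      using tree_maps_children[OF Grig_tree_maps[OF g(1)]] by blast
    then show "g w = w" using g(2) v w by auto
  qed
next
  assume fx: "\<forall>g\<in>Grig. g v = v \<longrightarrow> g w = w"
  obtain h where h: "h \<in> Grig" "h v = ones (Suc k)"
    using Grig_transitive[of v "ones (Suc k)"] len by auto
  have fx1: "g (h w) = h w" if g: "g \<in> Grig" "g (ones (Suc k)) = ones (Suc k)" for g
  proof -
    have "(finv h \<circ> g \<circ> h) v = v"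
      using g h Grig_inv(1)[OF h(1), of v] by simp
    moreover have "finv h \<circ> g \<circ> h \<in> Grig" using g h by (intro Grig_comp Grig_finv)
    ultimately have "(finv h \<circ> g \<circ> h) w = w" using fx by blast
    then show ?thesis using Grig_inv(2)[OF h(1), of "g (h w)"] by simp
  qed
  have tk: "take k (ones (Suc k)) = ones k" by (subst take_replicate) simp
  have "take k (h w) = ones k"
  proof (rule ccontr)
    assume ne: "take k (h w) \<noteq> ones k"
    have lw: "length (h w) = Suc k" using h len by simp
    have "h w \<noteq> ones (length (h w))"
    proof
      assume "h w = ones (length (h w))"
      then have "take k (h w) = take k (ones (Suc k))" unfolding lw by (rule arg_cong)
      then show False using ne unfolding tk by contradiction
    qed
    then obtain i w' where w': "h w = ones i @ False # w'" using ones_or_False by blast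
    have "w' \<noteq> []"
    proof
      assume "w' = []"
      then have "i = k" using w' lw by simp
      then show False using w' ne by simp
    qed
    then have aw: "grig_a w' \<noteq> w'" by (cases w') auto
    obtain g where g: "g \<in> Grig" "\<And>z. g (ones i @ z) = ones i @ grig_b z"
      using self_replicating[OF Grig_gens(2), of "ones i"] by blast
    have "g (h w) \<noteq> h w" unfolding w' g(2) using aw by simp
    moreover have "ones (Suc k) = ones i @ ones (Suc k - i)"
      using w' lw ones_add[of i "Suc k - i"] by simp
    then have "g (ones (Suc k)) = ones (Suc k)" using g(2) grig_bcd_ones by metis
    ultimately show False using fx1 g(1) by blast
  qed
  then have "take k (h w) = take k (h v)" unfolding h(2) tk .
  then have "h (take k w) = h (take k v)" using Grig_take[OF h(1)] by simp
  then show "take k v = take k w" using Grig_eq_iff[OF h(1)] by simp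
qed

lemma finite_level: "finite {w :: bool list. length w = n}"
  using finite_lists_length_eq[of "UNIV :: bool set" n] by simp

lemma tree_mapsI:
  assumes len: "\<And>w. length (f w) = length w" and "inj f" and take: "\<And>k w. f (take k w) = take k (f w)"
  shows "f \<in> tree_maps"
proof -
  have "w \<in> range f" for w
  proof -
    let ?S = "{u :: bool list. length u = length w}"
    have "f ` ?S = ?S"
    proof (rule endo_inj_surj[OF finite_level])
      show "f ` ?S \<subseteq> ?S" using len by auto
      show "inj_on f ?S" using assms(2) by (rule inj_on_subset) simp
    qed
    then show ?thesis by blast
  qed
  then have "bij f" using assms(2) by (auto simp: bij_def)
  then show ?thesis using len take by (auto simp: tree_maps_def)
qed

text \<open>
  Shorter words are padded to length \<open>l\<close> before applying \<open>p\<close>, and letters beyond the \<open>l\<close>-th are kept;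
  compatibility with prefixes makes the padding irrelevant.
\<close>

lemma extend_level_permutation:
  assumes len: "\<And>w. length w = l \<Longrightarrow> length (p w) = l"
    and pre: "\<And>k v w. k \<le> l \<Longrightarrow> length v = l \<Longrightarrow> length w = l \<Longrightarrow>
      take k (p v) = take k (p w) \<longleftrightarrow> take k v = take k w"
  shows "\<exists>t\<in>tree_maps. \<forall>w. length w = l \<longrightarrow> t w = p w"
proof -
  define e where "e w = take l (w @ ones l)" for w
  define t where "t w = take (length w) (p (e w) @ drop l w)" for w
  have le: "length (e w) = l" for w by (simp add: e_def)
  have lp: "length (p (e w)) = l" for w using len le by simp
  have lt: "length (t w) = length w" for w by (simp add: t_def lp)
  have te: "take k (e w) = take k w" if "k \<le> length w" "k \<le> l" for k w
    using that by (simp add: e_def)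
  have short: "t w = take (length w) (p (e w))" if "length w \<le> l" for w
    using that by (simp add: t_def lp)
  have long: "t w = p (take l w) @ drop l w" if "l \<le> length w" for w
    using that lp[of w] by (simp add: t_def e_def)
  have "inj t"
  proof (rule injI)
    fix v w assume eq: "t v = t w"
    then have lvw: "length v = length w" using lt by metis
    show "v = w"
    proof (cases "length w \<le> l")
      case True
      then have "take (length w) (p (e v)) = take (length w) (p (e w))"
        using eq short lvw by simp
      then have "take (length w) (e v) = take (length w) (e w)"
        using pre[OF True le le] by simp
      then show ?thesis using te[OF _ True, of v] te[OF _ True, of w] lvw by simp
    next
      case False
      have "length (p (take l v)) = l" "length (p (take l w)) = l"
        using False lvw len by auto
      then have "p (take l v) = p (take l w)" "drop l v = drop l w"
        using eq long False lvw by auto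
      moreover have "take l v = take l w"
        using pre[of l "take l v" "take l w"] calculation(1) False lvw by simp
      ultimately show ?thesis by (metis append_take_drop_id)
    qed
  qed
  moreover have "t (take k w) = take k (t w)" for k w
  proof (cases "k \<le> length w")
    case kw: True
    show ?thesis
    proof (cases "k \<le> l")
      case True
      have "take k (e (take k w)) = take k (e w)"
        using te[of k "take k w"] te[of k w] True kw by simp
      then have "take k (p (e (take k w))) = take k (p (e w))"
        using pre[OF True le le] by simp
      moreover have "t (take k w) = take k (p (e (take k w)))"
        using short[of "take k w"] kw True by simp
      moreover have "take k (t w) = take k (p (e w))"
        using True kw lp by (simp add: t_def)
      ultimately show ?thesis by simp
    next
      case False
      then have "length (p (take l w)) = l" using kw len by simp
      then show ?thesis
        using False kw long[of w] long[of "take k w"] by (simp add: drop_take)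
    qed
  next
    case False
    then show ?thesis using lt[of w] by simp
  qed
  ultimately have "t \<in> tree_maps" using tree_mapsI[of t] lt by blast
  moreover have "t w = p w" if "length w = l" for w
    using long[of w] that by simp
  ultimately show ?thesis by blast
qed

text \<open>
  Compatibility of the permutation with prefixes of length \<open>k\<close> is proved downwards from \<open>k = l\<close>.  Once
  it is known for length \<open>k + 1\<close>, the permutation intertwines the actions on level \<open>k + 1\<close> and hence
  preserves siblings there, which gives length \<open>k\<close>.
\<close>

lemma automorphism_induced_on_level:
  assumes iso: "\<phi> \<in> iso grigorchuk_group grigorchuk_group"
  obtains l t where "n \<le> l" "t \<in> tree_maps"
    "\<And>g w. g \<in> Grig \<Longrightarrow> length w = l \<Longrightarrow> t (g w) = \<phi> g (t w)"
proof -
  obtain l x p0 where l: "n \<le> l" "derived_step n \<subseteq> level_fix l" "x \<in> derived_step n" "length p0 = Suc l" "x p0 \<noteq> p0"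
    by (rule deep_level)
  note I = Grig_isoD[OF iso]
  have fG: "fixator u \<subseteq> Grig" for u by (auto simp: fixator_def)
  obtain p where p: "\<And>v. length v = l \<Longrightarrow> length (p v) = l \<and> \<phi> ` fixator v = fixator (p v)"
    using iso_fixator[OF iso l(2-5)] by metis
  have equiv: "p (g v) = \<phi> g (p v)" if g: "g \<in> Grig" and v: "length v = l" for g v
  proof -
    have "fixator (p (g v)) = \<phi> ` fixator (g v)" using p[of "g v"] g v by simp
    also have "\<dots> = (\<lambda>x. \<phi> (g \<circ> x \<circ> finv g)) ` fixator v"
      by (simp only: fixator_conj[OF g] image_image)
    also have "\<dots> = (\<lambda>x. \<phi> g \<circ> \<phi> x \<circ> finv (\<phi> g)) ` fixator v"
      using g fG by (intro image_cong) (auto simp: I(1,4) Grig_comp Grig_finv subset_iff)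
    also have "\<dots> = (\<lambda>x. \<phi> g \<circ> x \<circ> finv (\<phi> g)) ` (\<phi> ` fixator v)"
      by (simp only: image_image)
    also have "\<dots> = fixator (\<phi> g (p v))"
      using p[OF v] fixator_conj[OF I(5)[OF g]] by simp
    finally have "fixator (p (g v)) = fixator (\<phi> g (p v))" .
    then show ?thesis
      using fixator_incomparable[of "p (g v)" "\<phi> g (p v)"] p[of "g v"] p[OF v] g v I(5)[OF g] by simp
  qed
  have all_Grig: "(\<forall>g\<in>Grig. Q g) \<longleftrightarrow> (\<forall>g\<in>Grig. Q (\<phi> g))" for Q
    by (subst I(2)[symmetric]) simp
  have inj: "v = w" if "length v = l" "length w = l" "p v = p w" for v w
  proof -
    have "\<phi> ` fixator v = \<phi> ` fixator w" using p that by metis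
    then have "fixator v = fixator w" using inj_on_image_eq_iff[OF I(3) fG fG] by blast
    then show ?thesis using fixator_incomparable that by simp
  qed
  have pre: "\<forall>v w. length v = l \<longrightarrow> length w = l \<longrightarrow> (take k (p v) = take k (p w) \<longleftrightarrow> take k v = take k w)"
    if "k \<le> l" for k
    using that
  proof (induction k rule: inc_induct)
    case base
    then show ?case using inj p by auto
  next
    case (step k)
    show ?case
    proof (intro allI impI)
      fix v w :: "bool list" assume v: "length v = l" and w: "length w = l"
      let ?t = "take (Suc k)"
      have fx: "\<phi> g (?t (p u)) = ?t (p u) \<longleftrightarrow> g (?t u) = ?t u" if g: "g \<in> Grig" and u: "length u = l" for g u
      proof -
        have "\<phi> g (?t (p u)) = ?t (p (g u))"
          using equiv[OF g u] Grig_take[OF I(5)[OF g]] by simp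
        moreover have "g (?t u) = ?t (g u)" using Grig_take[OF g] .
        moreover have "?t (p (g u)) = ?t (p u) \<longleftrightarrow> ?t (g u) = ?t u"
          using step.IH u g by simp
        ultimately show ?thesis by simp
      qed
      have "take k (p v) = take k (p w) \<longleftrightarrow> take k (?t (p v)) = take k (?t (p w))"
        by simp
      also have "\<dots> \<longleftrightarrow> (\<forall>g\<in>Grig. g (?t (p v)) = ?t (p v) \<longrightarrow> g (?t (p w)) = ?t (p w))"
        using step.hyps p v w by (intro sibling_iff_stabiliser) auto
      also have "\<dots> \<longleftrightarrow> (\<forall>g\<in>Grig. \<phi> g (?t (p v)) = ?t (p v) \<longrightarrow> \<phi> g (?t (p w)) = ?t (p w))"
        by (rule all_Grig)
      also have "\<dots> \<longleftrightarrow> (\<forall>g\<in>Grig. g (?t v) = ?t v \<longrightarrow> g (?t w) = ?t w)"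
        using fx v w by simp
      also have "\<dots> \<longleftrightarrow> take k (?t v) = take k (?t w)"
        using step.hyps v w by (intro sibling_iff_stabiliser[symmetric]) auto
      also have "\<dots> \<longleftrightarrow> take k v = take k w" by simp
      finally show "take k (p v) = take k (p w) \<longleftrightarrow> take k v = take k w" .
    qed
  qed
  have "\<exists>t\<in>tree_maps. \<forall>w. length w = l \<longrightarrow> t w = p w"
  proof (rule extend_level_permutation)
    show "length (p w) = l" if "length w = l" for w using p[OF that] by simp
    show "take k (p v) = take k (p w) \<longleftrightarrow> take k v = take k w"
      if "k \<le> l" "length v = l" "length w = l" for k v w
      using pre[OF that(1)] that(2,3) by simp
  qed
  then obtain t where t: "t \<in> tree_maps" "\<And>w. length w = l \<Longrightarrow> t w = p w"
    by auto
  have "t (g w) = \<phi> g (t w)" if "g \<in> Grig" "length w = l" for g w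
    using t(2) equiv that by simp
  then show ?thesis using that l(1) t(1) by blast
qed

section \<open>Finite congruence quotients\<close>

text \<open>
  Keeping only the action on the first \<open>l\<close> letters realises the quotient by the stabiliser of
  level \<open>l\<close> as a group of tree automorphisms.
\<close>

definition truncation :: "nat \<Rightarrow> (bool list \<Rightarrow> bool list) \<Rightarrow> bool list \<Rightarrow> bool list"
  where "truncation l f w = f (take l w) @ drop l w"

lemma truncation_short: "length w \<le> l \<Longrightarrow> truncation l f w = f w"
  by (simp add: truncation_def)

lemma truncation_tree_maps:
  assumes f: "f \<in> tree_maps"
  shows "truncation l f \<in> tree_maps"
proof (rule tree_mapsI)
  note len = tree_mapsD(2)[OF f]
  show lt: "length (truncation l f w) = length w" for w
    by (simp add: truncation_def len)
  show "inj (truncation l f)"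
  proof (rule injI)
    fix v w assume eq: "truncation l f v = truncation l f w"
    then have "length v = length w" using lt by metis
    then have "f (take l v) = f (take l w)" "drop l v = drop l w"
      using eq by (auto simp: truncation_def len)
    then show "v = w" using tree_maps_eq_iff[OF f] by (metis append_take_drop_id)
  qed
  show "truncation l f (take k w) = take k (truncation l f w)" for k w
  proof (cases "k \<le> l")
    case True
    then have "take k (truncation l f w) = take k (f (take l w))"
      by (cases "length w \<le> l") (auto simp: truncation_def len)
    also have "\<dots> = f (take k w)" using tree_mapsD(3)[OF f, of k "take l w"] True by (simp add: min_def)
    finally show ?thesis using True by (simp add: truncation_def)
  next
    case False
    then show ?thesis
      by (cases "length w \<le> l") (auto simp: truncation_def len drop_take)
  qed
qed

lemma truncation_comp:
  assumes f: "f \<in> tree_maps" and g: "g \<in> tree_maps"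
  shows "truncation l (f \<circ> g) = truncation l f \<circ> truncation l g"
proof
  fix w
  show "truncation l (f \<circ> g) w = (truncation l f \<circ> truncation l g) w"
    by (cases "length w \<le> l") (simp_all add: truncation_def tree_mapsD(2)[OF g])
qed

lemma truncation_id: "truncation l id = id"
  by (auto simp: truncation_def)

lemma truncation_eqI:
  assumes "f \<in> tree_maps" "g \<in> tree_maps" "\<And>w. length w = l \<Longrightarrow> f w = g w"
  shows "truncation l f = truncation l g"
proof
  fix w
  have "f (take l w) = g (take l w)"
    by (rule tree_maps_eq_upto[OF assms(1,2,3)]) auto
  then show "truncation l f w = truncation l g w" by (simp add: truncation_def)
qed

lemma truncation_idem: "f \<in> tree_maps \<Longrightarrow> truncation l (truncation l f) = truncation l f"
  by (intro truncation_eqI truncation_tree_maps) (auto simp: truncation_short)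

lemma truncation_finv:
  assumes f: "f \<in> tree_maps"
  shows "truncation l (finv f) = finv (truncation l f)"
proof
  fix w
  have "f \<circ> finv f = id" using tree_maps_inv(2)[OF f] by auto
  then have "truncation l f \<circ> truncation l (finv f) = id"
    using truncation_comp[OF f tree_maps_inv(3)[OF f]] truncation_id by metis
  from fun_cong[OF this, of w] have "truncation l f (truncation l (finv f) w) = w" by simp
  then show "truncation l (finv f) w = finv (truncation l f) w"
    using tree_maps_inv(1)[OF truncation_tree_maps[OF f]] by metis
qed

lemma tree_maps_funpow: "f \<in> tree_maps \<Longrightarrow> f ^^ n \<in> tree_maps"
  by (induction n) (auto simp: tree_maps_id[unfolded id_def] tree_maps_id intro: tree_maps_comp)

text \<open>
  The \<open>2\<^sup>k\<close>-th power fixes level \<open>k\<close> and permutes pairs of children below it, so that its square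
  fixes level \<open>k + 1\<close>.
\<close>

lemma tree_maps_power_two_fixes:
  assumes f: "f \<in> tree_maps"
  shows "length w = k \<Longrightarrow> (f ^^ (2 ^ k)) w = w"
proof (induction k arbitrary: w)
  case 0
  then show ?case using tree_mapsD(2)[OF f, of w] by simp
next
  case (Suc k)
  let ?g = "f ^^ (2 ^ k)"
  obtain u x where w: "w = u @ [x]" "length u = k" using Suc.prems by (cases w rule: rev_cases) auto
  obtain e where "\<forall>x. ?g (u @ [x]) = u @ [e \<noteq> x]"
    using tree_maps_children[OF tree_maps_funpow[OF f] Suc.IH[OF w(2)]] by blast
  then have "?g (?g w) = w" using w by auto
  then show ?case by (simp add: mult_2 funpow_add)
qed

lemma truncated_power_two:
  assumes f: "f \<in> tree_maps" "truncation l f = f"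
  shows "f ^^ (2 ^ l) = id"
proof -
  have "truncation l (f ^^ n) = f ^^ n" for n
  proof (induction n)
    case 0
    show ?case unfolding funpow.simps by (rule truncation_id)
  next
    case (Suc n)
    then show ?case
      unfolding funpow.simps truncation_comp[OF f(1) tree_maps_funpow[OF f(1)]] f(2) by (rule arg_cong)
  qed
  then have "f ^^ (2 ^ l) = truncation l (f ^^ (2 ^ l))" by simp
  also have "\<dots> = truncation l id"
    using tree_maps_power_two_fixes[OF f(1)]
    by (intro truncation_eqI tree_maps_funpow f tree_maps_id) (simp only: id_apply)
  finally show ?thesis by (simp add: truncation_id)
qed

section \<open>Counting fixed points of a permutation of two-power order\<close>

lemma even_card_involution:
  assumes "finite P" "\<And>x. x \<in> P \<Longrightarrow> f x \<in> P" "\<And>x. x \<in> P \<Longrightarrow> f (f x) = x"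
  shows "even (card P) \<longleftrightarrow> even (card {x \<in> P. f x = x})"
  using assms
proof (induction P rule: finite_psubset_induct)
  case (psubset P)
  show ?case
  proof (cases "\<exists>x\<in>P. f x \<noteq> x")
    case False
    then have "{x \<in> P. f x = x} = P" by auto
    then show ?thesis by simp
  next
    case True
    then obtain x where x: "x \<in> P" "f x \<noteq> x" by blast
    have fx: "f x \<in> P" "f (f x) = x" using psubset.prems x by auto
    define Q where "Q = P - {x, f x}"
    have Q: "Q \<subset> P" using x by (auto simp: Q_def)
    have "f y \<in> Q" if "y \<in> Q" for y
      using that psubset.prems fx unfolding Q_def by (metis Diff_iff insert_iff singletonD)
    then have "even (card Q) \<longleftrightarrow> even (card {y \<in> Q. f y = y})"
      using psubset.IH[OF Q] psubset.prems Q by auto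
    moreover have "{y \<in> P. f y = y} = {y \<in> Q. f y = y}"
      using x fx by (auto simp: Q_def)
    moreover have "card P = Suc (Suc (card Q))"
    proof -
      have P: "insert x (insert (f x) Q) = P" using x fx by (auto simp: Q_def)
      have "finite Q" "x \<notin> insert (f x) Q" "f x \<notin> Q"
        using psubset.hyps x(2) by (auto simp: Q_def)
      then have "card (insert x (insert (f x) Q)) = Suc (Suc (card Q))" by simp
      then show ?thesis unfolding P .
    qed
    ultimately show ?thesis by simp
  qed
qed

text \<open>
  The \<open>2\<^sup>k\<close>-th power is an involution of \<open>P\<close>, and \<open>f\<close> restricts to its fixed points.
\<close>

lemma even_card_power_two:
  assumes "finite P" "\<And>x. x \<in> P \<Longrightarrow> f x \<in> P" "\<And>x. x \<in> P \<Longrightarrow> (f ^^ (2 ^ k)) x = x"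
  shows "even (card P) \<longleftrightarrow> even (card {x \<in> P. f x = x})"
  using assms
proof (induction k arbitrary: P)
  case 0
  then have "{x \<in> P. f x = x} = P" by auto
  then show ?case by simp
next
  case (Suc k)
  let ?g = "f ^^ (2 ^ k)"
  let ?Q = "{x \<in> P. ?g x = x}"
  have cl: "(f ^^ n) x \<in> P" if "x \<in> P" for x n
    using that Suc.prems(2) by (induction n) auto
  have "even (card P) \<longleftrightarrow> even (card ?Q)"
  proof (rule even_card_involution[OF Suc.prems(1)])
    show "?g (?g x) = x" if "x \<in> P" for x
      using Suc.prems(3)[OF that] by (simp add: mult_2 funpow_add)
  qed (rule cl)
  also have "\<dots> \<longleftrightarrow> even (card {x \<in> ?Q. f x = x})"
  proof (rule Suc.IH)
    show "finite ?Q" using Suc.prems(1) by simp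
    show "f x \<in> ?Q" if "x \<in> ?Q" for x
      using that Suc.prems(2) funpow_swap1[of f "2 ^ k" x] by auto
  qed simp
  also have "{x \<in> ?Q. f x = x} = {x \<in> P. f x = x}"
  proof -
    have "(f ^^ n) x = x" if "f x = x" for n x using that by (induction n) auto
    then show ?thesis by auto
  qed
  finally show ?case .
qed

section \<open>Centralisers in a finite quotient\<close>

text \<open>
  A finite group of tree automorphisms that change the first \<open>l\<close> letters only; it is a two-group,
  acting faithfully on level \<open>l\<close>.
\<close>

locale truncated_group =
  fixes l :: nat and H :: "(bool list \<Rightarrow> bool list) set"
  assumes finite_H: "finite H"
    and H_maps: "h \<in> H \<Longrightarrow> h \<in> tree_maps"
    and H_trunc: "h \<in> H \<Longrightarrow> truncation l h = h"
    and H_id: "id \<in> H"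
    and H_comp: "g \<in> H \<Longrightarrow> h \<in> H \<Longrightarrow> g \<circ> h \<in> H"
    and H_finv: "h \<in> H \<Longrightarrow> finv h \<in> H"
begin

text \<open>
  Multiplication by \<open>p\<close> is a permutation of two-power order without fixed points.
\<close>

lemma even_card_rist:
  assumes "p \<in> rist H u" "p \<noteq> id"
  shows "even (card (rist H u))"
proof -
  have p: "p \<in> tree_maps" "truncation l p = p" using assms H_maps H_trunc by (auto simp: rist_def)
  have fin: "finite (rist H u)" using finite_H by (rule finite_subset[OF rist_subset])
  have "even (card (rist H u)) \<longleftrightarrow> even (card {h \<in> rist H u. p \<circ> h = h})"
  proof (rule even_card_power_two[OF fin])
    show "p \<circ> h \<in> rist H u" if "h \<in> rist H u" for h
      using that assms(1) H_comp by (auto simp: rist_def)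
    have "(((\<circ>) p) ^^ n) h = (p ^^ n) \<circ> h" for n and h :: "bool list \<Rightarrow> bool list"
      by (induction n) auto
    then show "(((\<circ>) p) ^^ (2 ^ l)) h = h" for h :: "bool list \<Rightarrow> bool list"
      by (simp only: truncated_power_two[OF p] id_comp)
  qed
  moreover have "p \<circ> h \<noteq> h" if "h \<in> rist H u" for h
  proof
    assume "p \<circ> h = h"
    then have "p (h w) = h w" for w by (metis comp_apply)
    moreover have "h \<in> tree_maps" using that H_maps by (auto simp: rist_def)
    ultimately have "p w = w" for w using tree_maps_inv(2) by metis
    then show False using assms(2) by auto
  qed
  then have "{h \<in> rist H u. p \<circ> h = h} = {}" by blast
  ultimately show ?thesis by simp
qed

text \<open>
  Conjugation by \<open>y\<close> has two-power order on the two-group of elements of \<open>H\<close> supported below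
  \<open>u\<close>, so that it fixes an even number of them, hence more than the identity.
\<close>

lemma fixed_rist_element:
  assumes y: "y \<in> tree_maps" "truncation l y = y" "\<And>h. h \<in> H \<Longrightarrow> y \<circ> h \<circ> finv y \<in> H"
    and u: "y u = u" "p \<in> rist H u" "p \<noteq> id"
  shows "\<exists>z\<in>rist H u. z \<noteq> id \<and> z \<circ> y = y \<circ> z"
proof -
  let ?P = "rist H u" and ?f = "\<lambda>h. y \<circ> h \<circ> finv y"
  have fin: "finite ?P" using finite_H by (rule finite_subset[OF rist_subset])
  have fix_iff: "?f h = h \<longleftrightarrow> h \<circ> y = y \<circ> h" for h
  proof
    assume "?f h = h"
    then have "h \<circ> y = (y \<circ> h \<circ> finv y) \<circ> y" by simp
    also have "\<dots> = y \<circ> h" using tree_maps_inv(1)[OF y(1)] by auto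
    finally show "h \<circ> y = y \<circ> h" .
  next
    assume "h \<circ> y = y \<circ> h"
    then have "?f h = h \<circ> y \<circ> finv y" by simp
    also have "\<dots> = h" using tree_maps_inv(2)[OF y(1)] by auto
    finally show "?f h = h" .
  qed
  have "even (card ?P) \<longleftrightarrow> even (card {h \<in> ?P. ?f h = h})"
  proof (rule even_card_power_two[OF fin])
    show "?f h \<in> ?P" if "h \<in> ?P" for h
      using rist_conj[OF that y(1) y(3)] that u(1) rist_subset by auto
    \<comment> \<open>Stated without inverses of powers, so that \<open>y\<close> to the power \<open>2\<^sup>l\<close> can be cancelled directly.\<close>
    have rel: "(?f ^^ n) h \<circ> (y ^^ n) = (y ^^ n) \<circ> h" for n h
    proof (induction n)
      case (Suc n)
      have "(?f ^^ Suc n) h \<circ> y ^^ Suc n = y \<circ> ((?f ^^ n) h \<circ> (finv y \<circ> y) \<circ> y ^^ n)"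
        by (simp add: comp_assoc)
      also have "finv y \<circ> y = id" using tree_maps_inv(1)[OF y(1)] by auto
      also have "y \<circ> ((?f ^^ n) h \<circ> id \<circ> y ^^ n) = y \<circ> (y ^^ n \<circ> h)"
        by (simp only: comp_id Suc.IH)
      finally show ?case by (simp only: funpow.simps comp_assoc)
    qed simp
    show "(?f ^^ (2 ^ l)) h = h" if "h \<in> ?P" for h
      using rel[of "2 ^ l" h] truncated_power_two[OF y(1,2)] by simp
  qed
  then have ev: "even (card {h \<in> ?P. h \<circ> y = y \<circ> h})"
    using even_card_rist[OF u(2,3)] by (simp only: fix_iff)
  have "id \<in> {h \<in> ?P. h \<circ> y = y \<circ> h}" using H_id by (auto simp: rist_def)
  then have "{h \<in> ?P. h \<circ> y = y \<circ> h} \<noteq> {id}" using ev by auto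
  then show ?thesis using \<open>id \<in> _\<close> by blast
qed

text \<open>
  Let \<open>F i\<close> be the part of the centraliser of \<open>y\<close> that is supported below \<open>1\<^sup>i\<close>.  The vertex \<open>1\<^sup>i0\<close>
  is fixed by \<open>y\<close>, and a nontrivial \<open>z\<close> in \<open>F i\<close> supported below it yields two disjoint translates
  \<open>F (i + 1)\<close> and \<open>z F (i + 1)\<close> inside \<open>F i\<close>.
\<close>

lemma card_centraliser_ge:
  assumes y: "y \<in> tree_maps" "truncation l y = y" "\<And>h. h \<in> H \<Longrightarrow> y \<circ> h \<circ> finv y \<in> H"
    and ones: "y (ones j) = ones j"
    and rist: "\<And>i. i < j \<Longrightarrow> \<exists>p\<in>rist H (ones i @ [False]). p \<noteq> id"
  shows "2 ^ j \<le> card {h \<in> H. h \<circ> y = y \<circ> h}"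
proof -
  define F where "F i = {h \<in> rist H (ones i). h \<circ> y = y \<circ> h}" for i
  have finF: "finite (F i)" for i
    using finite_H by (rule finite_subset[rotated]) (auto simp: F_def rist_def)
  have "2 ^ (j - i) \<le> card (F i)" if "i \<le> j" for i
    using that
  proof (induction i rule: inc_induct)
    case base
    have "id \<in> F j" using H_id by (auto simp: F_def rist_def)
    then have "card (F j) \<noteq> 0" using finF by auto
    then show ?case by simp
  next
    case (step i)
    have "ones j = ones i @ [True] @ ones (j - Suc i)"
      using ones_add[of i "Suc (j - Suc i)"] step.hyps by simp
    then have pre: "prefix (ones i) (ones j)" "prefix (ones i @ [True]) (ones j)"
      by simp_all
    obtain e where e: "\<And>x. y (ones i @ [x]) = ones i @ [e \<noteq> x]"
      using tree_maps_children[OF y(1) tree_maps_fix_prefix[OF y(1) ones pre(1)]] by blast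
    have "y (ones i @ [False]) = ones i @ [False]"
      using e[of True] e[of False] tree_maps_fix_prefix[OF y(1) ones pre(2)] by auto
    then obtain z where z: "z \<in> rist H (ones i @ [False])" "z \<noteq> id" "z \<circ> y = y \<circ> z"
      using fixed_rist_element[OF y, of "ones i @ [False]"] rist[OF step.hyps(2)] by blast
    obtain q where q: "z q \<noteq> q" using z(2) by (metis ext id_apply)
    have zH: "z \<in> H" using z(1) by (simp add: rist_def)
    have mono: "F (Suc i) \<subseteq> F i"
      using rist_mono[of "ones i" "ones (Suc i)" H] unfolding F_def
      by (auto simp: prefix_iff_take min_def simp del: replicate_Suc)
    have "z \<in> rist H (ones i)" using z(1) rist_mono[of "ones i" "ones i @ [False]" H] by auto
    then have "z \<circ> h \<in> F i" if "h \<in> F i" for h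
      using that z(3) H_comp unfolding F_def rist_def by (auto simp: fun_eq_iff)
    then have sub: "F (Suc i) \<union> (\<circ>) z ` F (Suc i) \<subseteq> F i" using mono by auto
    have disj: "F (Suc i) \<inter> (\<circ>) z ` F (Suc i) = {}"
    proof (rule ccontr)
      assume "\<not> ?thesis"
      then obtain f where f: "f \<in> F (Suc i)" "z \<circ> f \<in> F (Suc i)" by blast
      have "prefix (ones i @ [False]) q" using rist_memD[OF z(1)] q by blast
      then have "\<not> prefix (ones (Suc i)) q"
        by (auto simp: prefix_def replicate_append_same[symmetric])
      then have "f q = q" "(z \<circ> f) q = q" using f unfolding F_def rist_def by auto
      then show False using q by simp
    qed
    have "inj_on ((\<circ>) z) (F (Suc i))"
      using tree_maps_eq_iff[OF H_maps[OF zH]] by (auto simp: inj_on_def fun_eq_iff)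
    then have "2 * card (F (Suc i)) = card (F (Suc i) \<union> (\<circ>) z ` F (Suc i))"
      using card_Un_disjoint[OF finF finite_imageI[OF finF] disj] by (simp add: card_image)
    also have "\<dots> \<le> card (F i)" using sub finF by (rule card_mono[rotated])
    finally have "2 * card (F (Suc i)) \<le> card (F i)" .
    moreover have "j - i = Suc (j - Suc i)" using step.hyps by simp
    ultimately show ?case using step.IH by simp
  qed
  from this[of 0] have "2 ^ j \<le> card (F 0)" by simp
  also have "\<dots> \<le> card {h \<in> H. h \<circ> y = y \<circ> h}"
    using finite_H by (intro card_mono) (auto simp: F_def rist_def)
  finally show ?thesis .
qed

definition conj_class :: "(bool list \<Rightarrow> bool list) \<Rightarrow> (bool list \<Rightarrow> bool list) set"
  where "conj_class y = (\<lambda>h. h \<circ> y \<circ> finv h) ` H"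

text \<open>
  One half of the orbit-stabiliser theorem: choosing for each conjugate \<open>z\<close> a conjugator \<open>r z\<close>, the
  products of conjugators and centralising elements are distinct.
\<close>

lemma card_conj_class_centraliser:
  assumes "y \<in> tree_maps"
  shows "card (conj_class y) * card {h \<in> H. h \<circ> y = y \<circ> h} \<le> card H"
proof -
  let ?C = "{h \<in> H. h \<circ> y = y \<circ> h}"
  have "\<forall>z\<in>conj_class y. \<exists>h\<in>H. z = h \<circ> y \<circ> finv h" by (auto simp: conj_class_def)
  then obtain r where r: "\<And>z. z \<in> conj_class y \<Longrightarrow> r z \<in> H \<and> z = r z \<circ> y \<circ> finv (r z)" by metis
  have key: "(r z \<circ> c) \<circ> y = z \<circ> (r z \<circ> c)" if "z \<in> conj_class y" "c \<in> ?C" for z c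
  proof
    fix w
    have "z v = r z (y (finv (r z) v))" for v
      using fun_cong[OF conjunct2[OF r[OF that(1)]], of v] by simp
    moreover have "c (y w) = y (c w)" using that(2) by (auto simp: fun_eq_iff)
    ultimately show "((r z \<circ> c) \<circ> y) w = (z \<circ> (r z \<circ> c)) w"
      using tree_maps_inv(1)[OF H_maps] r[OF that(1)] by simp
  qed
  have "inj_on (\<lambda>(z, c). r z \<circ> c) (conj_class y \<times> ?C)"
  proof (rule inj_onI, clarify)
    fix z c z' c'
    assume z: "z \<in> conj_class y" "z' \<in> conj_class y" and c: "c \<in> H" "c \<circ> y = y \<circ> c" "c' \<in> H" "c' \<circ> y = y \<circ> c'"
      and eq: "r z \<circ> c = r z' \<circ> c'"
    have "z \<circ> (r z \<circ> c) = z' \<circ> (r z \<circ> c)"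
      using key[OF z(1), of c] key[OF z(2), of c'] c unfolding eq by simp
    moreover have m: "r z \<circ> c \<in> tree_maps" using r[OF z(1)] c(1) H_comp H_maps by blast
    ultimately have "z w = z' w" for w
      using tree_maps_inv(2)[OF m, of w] by (metis comp_apply)
    then have "z = z'" by (rule ext)
    moreover have "c w = c' w" for w
      using fun_cong[OF eq, of w] tree_maps_eq_iff[OF H_maps, of "r z"] r[OF z(1)] \<open>z = z'\<close> by simp
    ultimately show "z = z' \<and> c = c'" by auto
  qed
  moreover have "(\<lambda>(z, c). r z \<circ> c) ` (conj_class y \<times> ?C) \<subseteq> H"
    using r H_comp by auto
  ultimately have "card (conj_class y \<times> ?C) \<le> card H"
    using card_inj_on_le finite_H by blast
  then show ?thesis by (simp add: card_cartesian_product)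
qed

end

lemma sum_inverse_class_sizes:
  assumes fin: "finite Y" and cl: "\<And>y. y \<in> Y \<Longrightarrow> y \<in> cl y \<and> cl y \<subseteq> Y"
    and eq: "\<And>y z. y \<in> Y \<Longrightarrow> z \<in> cl y \<Longrightarrow> cl z = cl y"
  shows "(\<Sum>y\<in>Y. 1 / real (card (cl y))) = real (card (cl ` Y))"
proof -
  have "(\<Sum>y\<in>Y. 1 / real (card (cl y))) = (\<Sum>C\<in>cl ` Y. \<Sum>y\<in>{y \<in> Y. cl y = C}. 1 / real (card (cl y)))"
    using sum.image_gen[OF fin] .
  also have "\<dots> = (\<Sum>C\<in>cl ` Y. 1)"
  proof (rule sum.cong[OF refl])
    fix C assume "C \<in> cl ` Y"
    then obtain y where y: "y \<in> Y" "C = cl y" by blast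
    have "{x \<in> Y. cl x = C} = C" using y cl eq by blast
    moreover have "finite C" "C \<noteq> {}" using y cl[OF y(1)] fin finite_subset by auto
    moreover have "(\<Sum>x\<in>{x \<in> Y. cl x = C}. 1 / real (card (cl x))) = (\<Sum>x\<in>{x \<in> Y. cl x = C}. 1 / real (card C))"
      by (intro sum.cong) auto
    ultimately show "(\<Sum>x\<in>{x \<in> Y. cl x = C}. 1 / real (card (cl x))) = 1"
      by (simp add: card_gt_0_iff)
  qed
  finally show ?thesis by simp
qed

section \<open>Infinitely many twisted conjugacy classes\<close>

lemma finite_truncations: "finite (truncation l ` tree_maps)"
proof -
  let ?S = "{w :: bool list. length w = l}"
  have "inj_on (\<lambda>h. restrict h ?S) (truncation l ` tree_maps)"
  proof (rule inj_onI, clarify)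
    fix f g assume fg: "f \<in> tree_maps" "g \<in> tree_maps"
      and eq: "restrict (truncation l f) ?S = restrict (truncation l g) ?S"
    have "f w = g w" if "length w = l" for w
      using fun_cong[OF eq, of w] that by (simp add: truncation_short)
    then show "truncation l f = truncation l g" by (rule truncation_eqI[OF fg])
  qed
  moreover have "(\<lambda>h. restrict h ?S) ` truncation l ` tree_maps \<subseteq> ?S \<rightarrow>\<^sub>E ?S"
  proof (rule image_subsetI)
    fix h assume "h \<in> truncation l ` tree_maps"
    then have "h \<in> tree_maps" using truncation_tree_maps by blast
    then show "restrict h ?S \<in> ?S \<rightarrow>\<^sub>E ?S"
      using tree_mapsD(2) by (simp add: restrict_PiE_iff)
  qed
  moreover have "finite (?S \<rightarrow>\<^sub>E ?S)"
    by (intro finite_PiE finite_level)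
  ultimately show ?thesis by (rule inj_on_finite)
qed

lemma truncated_group_Grig: "truncated_group l (truncation l ` Grig)"
proof
  have sub: "Grig \<subseteq> tree_maps" using Grig_tree_maps by blast
  show "finite (truncation l ` Grig)"
    using finite_truncations by (rule finite_subset[OF image_mono[OF sub]])
  show "h \<in> truncation l ` Grig \<Longrightarrow> h \<in> tree_maps" for h
    using truncation_tree_maps Grig_tree_maps by blast
  show "h \<in> truncation l ` Grig \<Longrightarrow> truncation l h = h" for h
    using truncation_idem Grig_tree_maps by blast
  show "id \<in> truncation l ` Grig"
    using truncation_id Grig_id by (metis image_eqI)
  show "g \<in> truncation l ` Grig \<Longrightarrow> h \<in> truncation l ` Grig \<Longrightarrow> g \<circ> h \<in> truncation l ` Grig" for g h
    by (auto simp: Grig_tree_maps truncation_comp[symmetric] intro!: imageI Grig_comp)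
  show "h \<in> truncation l ` Grig \<Longrightarrow> finv h \<in> truncation l ` Grig" for h
    by (auto simp: Grig_tree_maps truncation_finv[symmetric] intro!: imageI Grig_finv)
qed

text \<open>
  The rigid stabiliser of \<open>u\<close> contains a copy of \<open>(a b)\<^sup>2\<close>, which is visible two levels below \<open>u\<close>.
\<close>

lemma truncation_rist_nontrivial:
  assumes "length u + 2 \<le> l"
  shows "\<exists>p\<in>rist (truncation l ` Grig) u. p \<noteq> id"
proof -
  obtain x w where x: "x \<in> rist Grig u" "length w = length u + 2" "x w \<noteq> w"
    by (rule Grig_weakly_branch)
  have "truncation l x v = v" if "\<not> prefix u v" for v
  proof -
    have "\<not> prefix u (take l v)" using that take_is_prefix prefix_order.trans by blast
    then show ?thesis using rist_memD[OF x(1)] by (simp add: truncation_def)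
  qed
  then have "truncation l x \<in> rist (truncation l ` Grig) u"
    using x(1) by (auto simp: rist_def)
  moreover have "truncation l x w \<noteq> w" using x assms by (simp add: truncation_short)
  ultimately show ?thesis by (metis id_apply)
qed

text \<open>Left multiplication by a group transitive on level \<open>k\<close> equidistributes the images of a vertex.\<close>

lemma card_prescribed_image:
  assumes fin: "finite Y" and maps: "Y \<subseteq> tree_maps"
    and trans: "\<And>v w. length v = k \<Longrightarrow> length w = k \<Longrightarrow> \<exists>h\<in>tree_maps. h v = w \<and> (\<forall>y\<in>Y. h \<circ> y \<in> Y)"
    and u: "length u = k" and v: "length v = k"
  shows "card Y = 2 ^ k * card {y \<in> Y. y u = v}"
proof -
  let ?S = "{w :: bool list. length w = k}"
  let ?F = "\<lambda>w. {y \<in> Y. y u = w}"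
  have le: "card (?F w) \<le> card (?F w')" if w: "w \<in> ?S" "w' \<in> ?S" for w w'
  proof -
    obtain h where h: "h \<in> tree_maps" "h w = w'" "\<forall>y\<in>Y. h \<circ> y \<in> Y"
      using trans[of w w'] w by auto
    have "inj_on ((\<circ>) h) (?F w)"
      using tree_maps_eq_iff[OF h(1)] by (auto simp: inj_on_def fun_eq_iff)
    moreover have "(\<circ>) h ` ?F w \<subseteq> ?F w'" using h by auto
    ultimately show ?thesis using fin by (intro card_inj_on_le) auto
  qed
  have "card Y = (\<Sum>w\<in>?S. card (?F w))"
  proof -
    have "(\<lambda>y. y u) ` Y \<subseteq> ?S" using maps tree_mapsD(2) u by auto
    from sum.group[OF fin finite_level this, of "\<lambda>_. 1 :: nat"] show ?thesis by simp
  qed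
  also have "\<dots> = (\<Sum>w\<in>?S. card (?F v))"
    using le v by (intro sum.cong refl antisym) auto
  also have "\<dots> = 2 ^ k * card (?F v)"
    using card_lists_length_eq[of "UNIV :: bool set" k] by simp
  finally show ?thesis .
qed

text \<open>
  Every \<open>y\<close> that fixes \<open>1\<^sup>j\<close> and swaps its children has a class of size at most
  \<open>|H| / 2\<^sup>j\<close>.  Such \<open>y\<close> form a proportion \<open>2\<^sup>-\<^sup>(\<^sup>j\<^sup>+\<^sup>1\<^sup>)\<close> of the coset, so each \<open>j\<close>
  contributes at least one half to the number of classes.
\<close>

lemma (in truncated_group) card_coset_classes_ge:
  assumes t: "t \<in> tree_maps" "truncation l t = t"
    and norm: "\<And>h. h \<in> H \<Longrightarrow> \<exists>h'\<in>H. t \<circ> h = h' \<circ> t"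
    and trans: "\<And>v w. length v = length w \<Longrightarrow> length v \<le> l \<Longrightarrow> \<exists>h\<in>H. h v = w"
    and rist: "\<And>u. length u + 2 \<le> l \<Longrightarrow> \<exists>p\<in>rist H u. p \<noteq> id"
    and m: "m + 2 \<le> l"
  shows "m \<le> 2 * card (conj_class ` (\<lambda>h. h \<circ> t) ` H)"
proof -
  define Y where "Y = (\<lambda>h. h \<circ> t) ` H"
  have finY: "finite Y" using finite_H by (simp add: Y_def)
  have Ymaps: "Y \<subseteq> tree_maps" using H_maps t(1) by (auto simp: Y_def intro: tree_maps_comp)
  have cardY: "card Y = card H"
  proof -
    have "inj_on (\<lambda>h. h \<circ> t) H"
    proof (rule inj_onI)
      fix g h assume "g \<circ> t = h \<circ> t"
      then have "g (t w) = h (t w)" for w by (metis comp_apply)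
      then have "g w = h w" for w using tree_maps_inv(2)[OF t(1), of w] by metis
      then show "g = h" by (rule ext)
    qed
    then show ?thesis by (simp add: Y_def card_image)
  qed
  have Ytrunc: "truncation l y = y" if "y \<in> Y" for y
    using that t H_maps H_trunc by (auto simp: Y_def truncation_comp)
  have Yleft: "h \<circ> y \<in> Y" if "h \<in> H" "y \<in> Y" for h y
    using that H_comp unfolding Y_def by (auto simp: comp_assoc[symmetric])
  have Yright: "\<exists>h'\<in>H. y \<circ> h = h' \<circ> y" if y: "y \<in> Y" and h: "h \<in> H" for y h
  proof -
    obtain g where g: "g \<in> H" "y = g \<circ> t" using y by (auto simp: Y_def)
    obtain h' where h': "h' \<in> H" "t \<circ> h = h' \<circ> t" using norm[OF h] by blast
    have "y \<circ> h = (g \<circ> h') \<circ> t" using g h'(2) by (simp add: comp_assoc)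
    also have "\<dots> = (g \<circ> h' \<circ> finv g) \<circ> y"
      using g tree_maps_inv(1)[OF H_maps[OF g(1)]] by (auto simp: fun_eq_iff)
    finally show ?thesis using g(1) h'(1) H_comp H_finv by blast
  qed
  have Yconj: "y \<circ> h \<circ> finv y \<in> H" if y: "y \<in> Y" and h: "h \<in> H" for y h
  proof -
    obtain h' where h': "h' \<in> H" "y \<circ> h = h' \<circ> y" using Yright[OF y h] by blast
    have "y \<circ> finv y = id" using tree_maps_inv(2) Ymaps y by (auto simp: fun_eq_iff)
    then have "y \<circ> h \<circ> finv y = h'" using h'(2) by (simp add: comp_assoc)
    then show ?thesis using h' by simp
  qed
  have cl: "y \<in> conj_class y \<and> conj_class y \<subseteq> Y" if y: "y \<in> Y" for y
  proof
    have "finv (id :: bool list \<Rightarrow> bool list) = id" using inv_id .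
    then have "y = id \<circ> y \<circ> finv id" by simp
    then show "y \<in> conj_class y" unfolding conj_class_def using H_id by (rule image_eqI)
    show "conj_class y \<subseteq> Y"
    proof
      fix z assume "z \<in> conj_class y"
      then obtain h where h: "h \<in> H" "z = h \<circ> (y \<circ> finv h)" by (auto simp: conj_class_def comp_assoc)
      obtain h' where "h' \<in> H" "y \<circ> finv h = h' \<circ> y" using Yright[OF y H_finv[OF h(1)]] by blast
      then show "z \<in> Y" using h Yleft y by simp
    qed
  qed
  have eq: "conj_class z = conj_class y" if z: "z \<in> conj_class y" for y z
  proof -
    have sub: "conj_class z \<subseteq> conj_class y" if z: "z \<in> conj_class y" for y z
    proof
      fix x assume "x \<in> conj_class z"
      then obtain g h where gh: "g \<in> H" "h \<in> H" "x = g \<circ> z \<circ> finv g" "z = h \<circ> y \<circ> finv h"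
        using z by (auto simp: conj_class_def)
      have "finv (g \<circ> h) = finv h \<circ> finv g"
        using o_inv_distrib gh H_maps tree_mapsD(1) by metis
      then have "x = (g \<circ> h) \<circ> y \<circ> finv (g \<circ> h)" using gh by (simp add: comp_assoc)
      then show "x \<in> conj_class y" unfolding conj_class_def using gh H_comp by blast
    qed
    obtain h where h: "h \<in> H" "z = h \<circ> y \<circ> finv h" using z by (auto simp: conj_class_def)
    have "y = finv h \<circ> z \<circ> finv (finv h)"
      using h tree_maps_inv[OF H_maps[OF h(1)]] inv_inv_eq[OF tree_mapsD(1)[OF H_maps[OF h(1)]]]
      by (auto simp: fun_eq_iff)
    then have "y \<in> conj_class z" unfolding conj_class_def using H_finv[OF h(1)] by blast
    then show ?thesis using sub z by blast
  qed
  \<comment> \<open>The elements that fix the vertex \<open>1\<^sup>j\<close> and swap its children.\<close>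
  define A where "A j = {y \<in> Y. y (ones (Suc j)) = ones j @ [False]}" for j
  have cardA: "2 ^ Suc j * card (A j) = card H" if "j < m" for j
  proof -
    have "card Y = 2 ^ Suc j * card {y \<in> Y. y (ones (Suc j)) = ones j @ [False]}"
    proof (rule card_prescribed_image[OF finY Ymaps])
      show "\<exists>h\<in>tree_maps. h v = w \<and> (\<forall>y\<in>Y. h \<circ> y \<in> Y)"
        if "length v = Suc j" "length w = Suc j" for v w
        using trans[of v w] that \<open>j < m\<close> m H_maps Yleft by auto
    qed auto
    then show ?thesis by (simp add: A_def cardY)
  qed
  have disj: "A i \<inter> A j = {}" if "i \<noteq> j" for i j
  proof -
    have "A i \<inter> A j = {}" if "i < j" for i j
    proof (rule ccontr)
      assume "\<not> ?thesis"
      then obtain y where y: "y \<in> Y" "y (ones (Suc i)) = ones i @ [False]" "y (ones (Suc j)) = ones j @ [False]"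
        by (auto simp: A_def)
      have "y (take (Suc i) (ones (Suc j))) = take (Suc i) (y (ones (Suc j)))"
        using tree_mapsD(3) y(1) Ymaps by blast
      then have "ones i @ [False] = ones (Suc i)"
        using y(2,3) that by (simp add: min_def del: replicate_Suc)
      then show False by (simp add: replicate_append_same[symmetric])
    qed
    then show ?thesis using that by (metis inf_commute linorder_neqE_nat)
  qed
  have H0: "card H > 0" using H_id finite_H by (auto simp: card_gt_0_iff)
  have contrib: "2 ^ j / real (card H) \<le> 1 / real (card (conj_class y))" if j: "j < m" and y: "y \<in> A j" for j y
  proof -
    have yY: "y \<in> Y" using y by (simp add: A_def)
    then have ym: "y \<in> tree_maps" using Ymaps by blast
    have "y (ones j) = take j (ones j @ [False])"
      using y tree_mapsD(3)[OF ym, of j "ones (Suc j)"] by (simp add: A_def min_def del: replicate_Suc)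
    then have "y (ones j) = ones j" by simp
    then have "2 ^ j \<le> card {h \<in> H. h \<circ> y = y \<circ> h}"
      using j m by (intro card_centraliser_ge[OF ym Ytrunc[OF yY] Yconj[OF yY]] rist) auto
    then have "card (conj_class y) * 2 ^ j \<le> card H"
      using card_conj_class_centraliser[OF ym] by (meson le_trans mult_le_mono2)
    then have "real (card (conj_class y) * 2 ^ j) \<le> real (card H)" by (rule of_nat_mono)
    moreover have "card (conj_class y) > 0"
      using cl[OF yY] finY finite_subset by (auto simp: card_gt_0_iff)
    ultimately show ?thesis using H0 by (simp add: field_simps)
  qed
  have "real m / 2 = (\<Sum>j<m. 1 / 2)" by simp
  also have "\<dots> = (\<Sum>j<m. \<Sum>y\<in>A j. 2 ^ j / real (card H))"
  proof (rule sum.cong[OF refl])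
    fix j assume "j \<in> {..<m}"
    then have "real (card H) = 2 * 2 ^ j * real (card (A j))"
      using cardA[of j] by (metis lessThan_iff of_nat_mult of_nat_numeral of_nat_power power_Suc)
    moreover have "card (A j) > 0"
      using calculation H0 by (cases "card (A j) = 0") auto
    ultimately show "1 / 2 = (\<Sum>y\<in>A j. 2 ^ j / real (card H))" by (simp add: field_simps)
  qed
  also have "\<dots> \<le> (\<Sum>j<m. \<Sum>y\<in>A j. 1 / real (card (conj_class y)))"
    using contrib by (intro sum_mono) auto
  also have "\<dots> = (\<Sum>y\<in>(\<Union>j<m. A j). 1 / real (card (conj_class y)))"
    using finY disj by (intro sum.UNION_disjoint[symmetric]) (auto simp: A_def)
  also have "\<dots> \<le> (\<Sum>y\<in>Y. 1 / real (card (conj_class y)))"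
    using finY by (intro sum_mono2) (auto simp: A_def)
  also have "\<dots> = real (card (conj_class ` Y))"
    using sum_inverse_class_sizes[OF finY cl eq] .
  finally show ?thesis by (simp add: Y_def)
qed

text \<open>
  On level \<open>l\<close> the map \<open>x \<mapsto> x t\<close> turns \<open>g x \<phi>(g\<^sup>-\<^sup>1)\<close> into \<open>g (x t) g\<^sup>-\<^sup>1\<close>, and thus Reidemeister
  classes onto conjugacy classes of the coset.
\<close>

lemma reidemeister_classes_level_ge:
  assumes iso: "\<phi> \<in> iso grigorchuk_group grigorchuk_group"
    and fin: "finite (reidemeister_classes grigorchuk_group \<phi>)"
  shows "m \<le> 2 * card (reidemeister_classes grigorchuk_group \<phi>)"
proof -
  note I = Grig_isoD[OF iso]
  obtain l s where l: "m + 2 \<le> l" and s: "s \<in> tree_maps"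
    and eqv: "\<And>g w. g \<in> Grig \<Longrightarrow> length w = l \<Longrightarrow> s (g w) = \<phi> g (s w)"
    using automorphism_induced_on_level[OF iso, of "m + 2"] by metis
  let ?T = "truncation l"
  define t where "t = ?T s"
  have t: "t \<in> tree_maps" "?T t = t"
    unfolding t_def by (intro truncation_tree_maps truncation_idem s)+
  interpret Q: truncated_group l "?T ` Grig" by (rule truncated_group_Grig)
  have comp: "?T (f \<circ> g) = ?T f \<circ> ?T g" if "f \<in> Grig" "g \<in> Grig" for f g
    using truncation_comp that Grig_tree_maps by blast
  have norm: "t \<circ> ?T g = ?T (\<phi> g) \<circ> t" if g: "g \<in> Grig" for g
  proof -
    have gm: "g \<in> tree_maps" "\<phi> g \<in> tree_maps" using g I(5) Grig_tree_maps by auto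
    have "t \<circ> ?T g = ?T (s \<circ> g)" unfolding t_def using truncation_comp s gm by simp
    also have "\<dots> = ?T (\<phi> g \<circ> s)"
      using eqv[OF g] s gm by (intro truncation_eqI tree_maps_comp) auto
    also have "\<dots> = ?T (\<phi> g) \<circ> t" unfolding t_def using truncation_comp s gm by simp
    finally show ?thesis .
  qed
  have "m \<le> 2 * card (Q.conj_class ` (\<lambda>h. h \<circ> t) ` ?T ` Grig)"
  proof (rule Q.card_coset_classes_ge[OF t _ _ truncation_rist_nontrivial l])
    show "\<exists>h'\<in>?T ` Grig. t \<circ> h = h' \<circ> t" if "h \<in> ?T ` Grig" for h
      using that norm I(5) by blast
    show "\<exists>h\<in>?T ` Grig. h v = w" if vw: "length v = length w" "length v \<le> l" for v w :: "bool list"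
    proof -
      obtain g where "g \<in> Grig" "g v = w" by (rule Grig_transitive[OF vw(1)])
      then show ?thesis using vw(2) by (auto simp: truncation_short intro!: bexI[of _ g])
    qed
  qed
  also have "card (Q.conj_class ` (\<lambda>h. h \<circ> t) ` ?T ` Grig) \<le> card (reidemeister_classes grigorchuk_group \<phi>)"
  proof -
    let ?\<Theta> = "\<lambda>x. ?T x \<circ> t"
    have cls: "?\<Theta> ` (twisted_conj grigorchuk_group \<phi> `` {x}) = Q.conj_class (?\<Theta> x)" if x: "x \<in> Grig" for x
    proof -
      have step: "?\<Theta> (g \<circ> x \<circ> \<phi> (finv g)) = ?T g \<circ> ?\<Theta> x \<circ> finv (?T g)" if g: "g \<in> Grig" for g
      proof -
        have gi: "finv g \<in> Grig" "\<phi> (finv g) \<in> Grig" using g I(5) Grig_finv by auto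
        have "?\<Theta> (g \<circ> x \<circ> \<phi> (finv g)) = ?T g \<circ> ?T x \<circ> (?T (\<phi> (finv g)) \<circ> t)"
          using g x gi by (simp add: comp Grig_comp comp_assoc)
        also have "\<dots> = ?T g \<circ> ?\<Theta> x \<circ> ?T (finv g)"
          by (simp only: norm[OF gi(1), symmetric] comp_assoc)
        also have "?T (finv g) = finv (?T g)"
          using truncation_finv g Grig_tree_maps by blast
        finally show ?thesis .
      qed
      have tw: "(x, y) \<in> twisted_conj grigorchuk_group \<phi> \<longleftrightarrow> (\<exists>g\<in>Grig. y = g \<circ> x \<circ> \<phi> (finv g))" for y
      proof -
        have "g \<circ> x \<circ> \<phi> (finv g) \<in> Grig" if "g \<in> Grig" for g
          using that x by (intro Grig_comp I(5) Grig_finv)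
        moreover have inv: "(\<exists>g\<in>Grig. y = g \<circ> x \<circ> \<phi> (inv\<^bsub>grigorchuk_group\<^esub> g))
            \<longleftrightarrow> (\<exists>g\<in>Grig. y = g \<circ> x \<circ> \<phi> (finv g))"
          by (intro bex_cong refl) (simp only: Grig_m_inv)
        ultimately show ?thesis
          unfolding twisted_conj_def mem_Collect_eq case_prod_conv Grig_mult inv using x by blast
      qed
      then have "twisted_conj grigorchuk_group \<phi> `` {x} = (\<lambda>g. g \<circ> x \<circ> \<phi> (finv g)) ` Grig"
        unfolding Image_singleton image_def by simp
      then have "?\<Theta> ` (twisted_conj grigorchuk_group \<phi> `` {x}) = (\<lambda>g. ?\<Theta> (g \<circ> x \<circ> \<phi> (finv g))) ` Grig"
        by (simp only: image_image)
      also have "\<dots> = (\<lambda>g. ?T g \<circ> ?\<Theta> x \<circ> finv (?T g)) ` Grig"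
        by (rule image_cong[OF refl step])
      also have "\<dots> = Q.conj_class (?\<Theta> x)"
        unfolding Q.conj_class_def by (simp only: image_image)
      finally show ?thesis .
    qed
    have "Q.conj_class ` (\<lambda>h. h \<circ> t) ` ?T ` Grig = (\<lambda>x. Q.conj_class (?\<Theta> x)) ` Grig"
      by (simp only: image_image)
    also have "\<dots> = (\<lambda>C. ?\<Theta> ` C) ` reidemeister_classes grigorchuk_group \<phi>"
      unfolding reidemeister_classes_def quotient_def using cls by (auto simp: image_iff) 
    finally show ?thesis using card_image_le[OF fin] by simp
  qed
  finally show ?thesis by simp
qed

theorem mainTheorem4:
  assumes "\<phi> \<in> iso grigorchuk_group grigorchuk_group"
  shows "reidemeister_number grigorchuk_group \<phi> = \<infinity>"
proof -
  have "\<not> finite (reidemeister_classes grigorchuk_group \<phi>)"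
  proof
    assume "finite (reidemeister_classes grigorchuk_group \<phi>)"
    from reidemeister_classes_level_ge[OF assms this, of "Suc (2 * card (reidemeister_classes grigorchuk_group \<phi>))"]
    show False by simp
  qed
  then show ?thesis by (simp add: reidemeister_number_def)
qed

end
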